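(* Let $L/K$ be a finite extension, let $L_S/K$ be its maximal separable subextension, let $L_I/K$ be its maximal purely inseparable subextension, and let $i_K(L)=[L_I:K]$. Let $F'/K$ be the maximal normal subextension of $L/K$ and $F/K$ the largest Galois subextension of $L/K$. Then (1) $F'=FL_I$ and $a_K(L)=t_K(L)\cdot i_K(L)$. (2) $a_K(L)\cdot u_K(L)=[L_SL_I:K]$. (3) $L/K$ is normal if and only if $a_K(L)=[L:K]$.
   Context: $K$ is any field (not necessarily perfect) with a fixed algebraic closure $\bar K$; all extensions are finite and contained in $\bar K$. The ascending index of $L/K$ is $t_K(L)=[F:K]$, and $u_K(L)=[L_S:F]$ (note $F\subset L_S$). The ascending normal index is $a_K(L)=[F':K]$, where $F'/K$ is the normal subextension of $L/K$ of maximum possible degree. *)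

theory Defs
  imports "HOL-Algebra.Algebra"
begin

text \<open>
  Throughout, the ambient structure is an algebraic closure of the base field \<open>K\<close> (locale
  \<open>algebraic_closure\<close>), and all extensions of \<open>K\<close> are subfields of it, given by their carriers.
  The degree \<open>[E : K]\<close> is \<open>(dim over K) E\<close>; the compositum \<open>E E'\<close> is the subfield generated by
  \<open>E \<union> E'\<close>.
\<close>

definition (in ring) subextension :: "'a set \<Rightarrow> 'a set \<Rightarrow> 'a set \<Rightarrow> bool"
  where "subextension K L E \<longleftrightarrow> subfield E R \<and> K \<subseteq> E \<and> E \<subseteq> L"

definition (in ring) compositum :: "'a set \<Rightarrow> 'a set \<Rightarrow> 'a set"
  where "compositum E E' = generate_field R (E \<union> E')"

text \<open>
  The minimal polynomial has no multiple root. The roots are taken in the ambient ring, so this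
  is the usual notion only when the ambient ring is algebraically closed.
\<close>

definition (in ring) separable_element :: "'a set \<Rightarrow> 'a \<Rightarrow> bool"
  where "separable_element K x \<longleftrightarrow>
    (algebraic over K) x \<and> (\<forall>y \<in> carrier R. alg_mult (Irr K x) y \<le> 1)"

definition (in ring) separable_extension :: "'a set \<Rightarrow> 'a set \<Rightarrow> bool"
  where "separable_extension K E \<longleftrightarrow> (\<forall>x \<in> E. separable_element K x)"

text \<open>
  The characteristic is the additive order of \<open>\<one>\<close>, where \<open>group.ord\<close> is \<open>0\<close> for elements of
  infinite order. The exponent is therefore \<open>p\<close> in characteristic \<open>p > 0\<close> and \<open>1\<close> in
  characteristic \<open>0\<close>.
\<close>

definition (in ring) characteristic_exponent :: nat
  where "characteristic_exponent = max 1 (group.ord (add_monoid R) \<one>)"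

definition (in ring) purely_inseparable_extension :: "'a set \<Rightarrow> 'a set \<Rightarrow> bool"
  where "purely_inseparable_extension K E \<longleftrightarrow>
    (\<forall>x \<in> E. \<exists>n::nat. x [^] (characteristic_exponent ^ n) \<in> K)"

text \<open>
  Splitting over \<open>E\<close> is the library's \<open>splitted\<close> in the field \<open>E\<close> itself. The library's
  \<open>splitted_on\<close> would be wrong: it ignores multiplicities of roots and is meaningless for
  infinite \<open>E\<close>.
\<close>

definition (in ring) normal_extension :: "'a set \<Rightarrow> 'a set \<Rightarrow> bool"
  where "normal_extension K E \<longleftrightarrow>
    (\<forall>x \<in> E. (algebraic over K) x) \<and>
    (\<forall>p \<in> carrier (K[X]). pirreducible K p \<and> (\<exists>x \<in> E. eval p x = \<zero>)
        \<longrightarrow> ring.splitted (R \<lparr> carrier := E \<rparr>) p)"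

definition (in ring) galois_extension :: "'a set \<Rightarrow> 'a set \<Rightarrow> bool"
  where "galois_extension K E \<longleftrightarrow> normal_extension K E \<and> separable_extension K E"

text \<open>
  \<open>L\<^sub>S\<close>, \<open>L\<^sub>I\<close> and \<open>F\<close> are the largest subextensions of \<open>L/K\<close> with respect to inclusion having the
  given property; \<open>F'\<close> is the normal subextension of largest degree.
\<close>

definition (in ring) maximal_separable :: "'a set \<Rightarrow> 'a set \<Rightarrow> 'a set"
  where "maximal_separable K L =
    (GREATEST E. subextension K L E \<and> separable_extension K E)"

definition (in ring) maximal_purely_inseparable :: "'a set \<Rightarrow> 'a set \<Rightarrow> 'a set"
  where "maximal_purely_inseparable K L =
    (GREATEST E. subextension K L E \<and> purely_inseparable_extension K E)"

definition (in ring) maximal_galois :: "'a set \<Rightarrow> 'a set \<Rightarrow> 'a set"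
  where "maximal_galois K L =
    (GREATEST E. subextension K L E \<and> galois_extension K E)"

definition (in ring) maximal_normal :: "'a set \<Rightarrow> 'a set \<Rightarrow> 'a set"
  where "maximal_normal K L =
    (THE E. is_arg_max (dim over K) (\<lambda>E. subextension K L E \<and> normal_extension K E) E)"

definition (in ring) inseparable_index :: "'a set \<Rightarrow> 'a set \<Rightarrow> nat"  (* i_K(L) *)
  where "inseparable_index K L = (dim over K) (maximal_purely_inseparable K L)"

definition (in ring) ascending_index :: "'a set \<Rightarrow> 'a set \<Rightarrow> nat"  (* t_K(L) *)
  where "ascending_index K L = (dim over K) (maximal_galois K L)"

definition (in ring) separable_coindex :: "'a set \<Rightarrow> 'a set \<Rightarrow> nat"  (* u_K(L) *)
  where "separable_coindex K L = (dim over (maximal_galois K L)) (maximal_separable K L)"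

definition (in ring) ascending_normal_index :: "'a set \<Rightarrow> 'a set \<Rightarrow> nat"  (* a_K(L) *)
  where "ascending_normal_index K L = (dim over K) (maximal_normal K L)"

end

theory Submission
  imports Defs
begin

text \<open>
  Let \<open>p\<close> be the characteristic exponent. An algebraic element \<open>x\<close> is separable over \<open>K\<close> iff
  \<open>x \<in> K(x\<^sup>p)\<close>. Hence a finite extension \<open>E\<close> generated by separable elements is spanned over \<open>K\<close> by
  the \<open>p\<close>-th powers of a basis, so Frobenius preserves linear independence over \<open>K\<close> in \<open>E\<close>. This
  shows that \<open>E\<close> is separable, and that \<open>E\<close> is linearly disjoint from every purely inseparable
  extension \<open>I\<close>, so that \<open>[EI : K] = [E : K] [I : K]\<close>.

  \<open>F'\<close> consists of the elements of \<open>L\<close> all of whose \<open>K\<close>-conjugates lie in \<open>L\<close>; it is a field because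
  a \<open>K\<close>-homomorphism sending \<open>a + b\<close> to a conjugate sends \<open>a\<close> and \<open>b\<close> to conjugates. An \<open>x \<in> F'\<close> is
  separable over \<open>L\<^sub>I\<close>, so \<open>x \<in> L\<^sub>I(x\<^sup>q)\<close> for every power \<open>q\<close> of \<open>p\<close>, and \<open>x\<^sup>q \<in> F\<close> for large \<open>q\<close>;
  therefore \<open>F' = F L\<^sub>I\<close>. The degree formulas follow from linear disjointness applied to \<open>F\<close> and
  \<open>L\<^sub>S\<close>.
\<close>

section \<open>The Frobenius homomorphism\<close>

text \<open>The usual route to F' = F L_I goes through the automorphism group of F' and its fixed
  field. No group appears here: that F' is separable over L_I is read off a minimal polynomial by
  taking p-th roots of its coefficients, which exist because the ambient field is algebraically
  closed. The base field changes along the way (K, L_I, K(x^p)), so the general lemmas carry it as a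
  variable. The criterion x in K(x^p) replaces multiplicities of roots by a membership, which can be
  handled with spans and dimensions. Multiplicities enter mainly through its proof, by way of the
  formal derivative: an irreducible polynomial with a multiple root has derivative 0 and is a
  polynomial in X^p. For exponent 1, Frobenius is the identity and the criterion reads x in K(x), so
  characteristic 0 needs no separate argument after the Frobenius lemmas. The maximal subextensions
  are given by \<open>GREATEST\<close> and \<open>THE\<close>, so each is known only after a
  candidate has been shown to be a field with the maximality property. Hence the explicit sets of
  elements, and hence the work on closure under field operations.\<close>

locale alg_closed_field = algebraically_closed R for R (structure)

lemma (in cring) binomial:
  assumes x: "x \<in> carrier R" and y: "y \<in> carrier R"
  shows "(x \<oplus> y) [^] (n::nat) = (\<Oplus>k\<in>{..n}. [(n choose k)] \<cdot> (x [^] k \<otimes> y [^] (n - k)))"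
proof (induction n)
  case 0
  then show ?case by (simp add: x y)
next
  case (Suc n)
  let ?S = "\<Oplus>k\<in>{..n}. [(n choose k)] \<cdot> (x [^] k \<otimes> y [^] (n - k))"
  have 1: "?S \<otimes> x = (\<Oplus>k\<in>{..n}. [(n choose k)] \<cdot> (x [^] Suc k \<otimes> y [^] (n - k)))"
    using x y by (subst finsum_ldistr) (auto simp: add_pow_ldistr add_pow_rdistr m_ac intro!: finsum_cong')
  have "?S \<otimes> y = (\<Oplus>k\<in>{..n}. [(n choose k)] \<cdot> (x [^] k \<otimes> y [^] (Suc n - k)))"
    using x y by (subst finsum_ldistr)
      (auto simp: add_pow_ldistr add_pow_rdistr m_ac Suc_diff_le intro!: finsum_cong')
  \<comment> \<open>The added top term vanishes since \<open>n choose Suc n\<close> is 0; it makes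
    the range long enough for the shift of the index.\<close>
  also have "\<dots> = (\<Oplus>k\<in>{..Suc n}. [(n choose k)] \<cdot> (x [^] k \<otimes> y [^] (Suc n - k)))"
    using x y by (subst finsum_Suc) (auto simp: binomial_eq_0)
  also have "\<dots> = (\<Oplus>k\<in>{..n}. [(n choose Suc k)] \<cdot> (x [^] Suc k \<otimes> y [^] (n - k)))
      \<oplus> y [^] Suc n"
    using x y by (subst finsum_Suc2) auto
  finally have 2: "?S \<otimes> y = (\<Oplus>k\<in>{..n}. [(n choose Suc k)] \<cdot> (x [^] Suc k \<otimes> y [^] (n - k)))
      \<oplus> y [^] Suc n" .
  have "(\<Oplus>k\<in>{..Suc n}. [(Suc n choose k)] \<cdot> (x [^] k \<otimes> y [^] (Suc n - k)))
    = (\<Oplus>k\<in>{..n}. [(Suc n choose Suc k)] \<cdot> (x [^] Suc k \<otimes> y [^] (n - k))) \<oplus> y [^] Suc n"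
    using x y by (subst finsum_Suc2) auto
  also have "(\<Oplus>k\<in>{..n}. [(Suc n choose Suc k)] \<cdot> (x [^] Suc k \<otimes> y [^] (n - k)))
    = (\<Oplus>k\<in>{..n}. [(n choose k)] \<cdot> (x [^] Suc k \<otimes> y [^] (n - k))
        \<oplus> [(n choose Suc k)] \<cdot> (x [^] Suc k \<otimes> y [^] (n - k)))"
    using x y by (intro finsum_cong') (auto simp: add.nat_pow_mult)
  also have "\<dots> = ?S \<otimes> x \<oplus> (\<Oplus>k\<in>{..n}. [(n choose Suc k)] \<cdot> (x [^] Suc k \<otimes> y [^] (n - k)))"
    unfolding 1 using x y by (intro finsum_addf) auto
  finally have "(\<Oplus>k\<in>{..Suc n}. [(Suc n choose k)] \<cdot> (x [^] k \<otimes> y [^] (Suc n - k)))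
    = ?S \<otimes> x \<oplus> ?S \<otimes> y"
    unfolding 2 using x y by (simp add: a_assoc)
  also have "\<dots> = (x \<oplus> y) [^] Suc n"
    using x y by (simp add: Suc r_distr)
  finally show ?case ..
qed

abbreviation (in ring) charexp :: nat
  where "charexp \<equiv> characteristic_exponent"

text \<open>Exponent 1 can only come from infinite order: additive order 1 of \<open>\<one>\<close>
  would mean \<open>\<one> = \<zero>\<close>.\<close>

lemma (in domain) add_pow_one_eq_zero_iff:
  "[(n::nat)] \<cdot> \<one> = \<zero> \<longleftrightarrow> (if charexp = 1 then n = 0 else charexp dvd n)"
proof -
  have eq: "[n] \<cdot> \<one> = \<zero> \<longleftrightarrow> add.ord \<one> dvd n"
    using add.pow_eq_id[of \<one> n] by simp
  have "add.ord \<one> \<noteq> 1"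
    using add.ord_eq_1[of \<one>] by simp
  then show ?thesis
    unfolding eq characteristic_exponent_def by (cases "add.ord \<one>") auto
qed

lemma (in domain) charexp_prime:
  assumes "charexp \<noteq> 1" shows "Factorial_Ring.prime charexp"
proof (rule prime_natI)
  show "charexp \<ge> 2" using assms unfolding characteristic_exponent_def by simp
  fix m n assume "charexp dvd m * n"
  then have "[(m * n)] \<cdot> \<one> = \<zero>" using assms by (simp add: add_pow_one_eq_zero_iff)
  moreover have "[(m * n)] \<cdot> \<one> = [m] \<cdot> \<one> \<otimes> [n] \<cdot> \<one>"
    using add_pow_ldistr[of \<one> "[n] \<cdot> \<one>" m] add.nat_pow_pow[of \<one> m n]
    by (simp add: mult.commute)
  ultimately have "[m] \<cdot> \<one> = \<zero> \<or> [n] \<cdot> \<one> = \<zero>"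
    using integral[of "[m] \<cdot> \<one>" "[n] \<cdot> \<one>"] by auto
  then show "charexp dvd m \<or> charexp dvd n"
    using assms by (simp add: add_pow_one_eq_zero_iff)
qed

lemma (in ring) subring_pow_closed: "subring E R \<Longrightarrow> x \<in> E \<Longrightarrow> x [^] (n::nat) \<in> E"
  by (induction n) (auto simp: subringE(3,6))

lemma (in ring) charexp_pos [simp]: "charexp > 0"
  unfolding characteristic_exponent_def by simp

lemma (in domain) add_pow_eq_zero_iff:
  assumes "x \<in> carrier R"
  shows "[(n::nat)] \<cdot> x = \<zero> \<longleftrightarrow> x = \<zero> \<or> [n] \<cdot> \<one> = \<zero>"
proof -
  have "[n] \<cdot> x = [n] \<cdot> \<one> \<otimes> x"
    using add_pow_ldistr[of \<one> x n] assms by simp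
  then show ?thesis
    using integral_iff[of "[n] \<cdot> \<one>" x] assms by auto
qed

lemma (in domain) charexp_pow_add:
  assumes x: "x \<in> carrier R" and y: "y \<in> carrier R"
  shows "(x \<oplus> y) [^] charexp = x [^] charexp \<oplus> y [^] charexp"
proof (cases "charexp = 1")
  case True
  with assms show ?thesis by simp
next
  case False
  let ?p = "charexp"
  let ?f = "\<lambda>k. [(?p choose k)] \<cdot> (x [^] k \<otimes> y [^] (?p - k))"
  obtain m where m: "?p = Suc (Suc m)"
    using charexp_prime[OF False] by (metis prime_ge_2_nat add_2_eq_Suc le_Suc_ex)
  have zero: "?f k = \<zero>" if "k \<in> {0<..<?p}" for k
  proof -
    have "?p dvd ?p choose k"
      using charexp_prime[OF False] that by (intro dvd_choose_prime) auto
    then show ?thesis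
      using x y False by (subst add_pow_eq_zero_iff) (auto simp: add_pow_one_eq_zero_iff)
  qed
  have "(\<Oplus>k\<in>{..m}. ?f (Suc k)) = (\<Oplus>k\<in>{..m}. \<zero>)"
    using zero m by (intro finsum_cong'[OF refl _ zero]) auto
  then have "(\<Oplus>k\<in>{..m}. ?f (Suc k)) = \<zero>" by simp
  moreover have "(\<Oplus>k\<in>{..Suc (Suc m)}. ?f k)
    = ?f (Suc (Suc m)) \<oplus> ((\<Oplus>k\<in>{..m}. ?f (Suc k)) \<oplus> ?f 0)"
    using x y by (subst finsum_Suc, simp, subst finsum_Suc2) auto
  ultimately have "(\<Oplus>k\<in>{..Suc (Suc m)}. ?f k) = ?f (Suc (Suc m)) \<oplus> ?f 0"
    using x y by simp
  then show ?thesis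
    using x y binomial[OF x y, of ?p] m by simp
qed

lemma (in domain) frobenius_hom:
  "ring_hom_ring R R (\<lambda>x. x [^] (charexp ^ e))"
proof (rule ring_hom_ringI2)
  show "(\<lambda>x. x [^] (charexp ^ e)) \<in> ring_hom R R"
  proof (induction e)
    case 0
    show ?case by (auto intro!: ring_hom_memI)
  next
    case (Suc e)
    have pow: "x [^] (charexp ^ Suc e) = (x [^] (charexp ^ e)) [^] charexp" if "x \<in> carrier R" for x
      using that by (simp add: nat_pow_pow mult.commute)
    show ?case
    proof (rule ring_hom_memI)
      fix x y assume xy: "x \<in> carrier R" "y \<in> carrier R"
      show "(x \<oplus> y) [^] (charexp ^ Suc e) = x [^] (charexp ^ Suc e) \<oplus> y [^] (charexp ^ Suc e)"
        using xy ring_hom_add[OF Suc xy] charexp_pow_add by (simp add: pow del: power_Suc)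
    qed (auto simp: nat_pow_distrib)
  qed
qed (rule ring_axioms)+

lemma (in domain) nat_pow_zero_imp_zero:
  "x \<in> carrier R \<Longrightarrow> x [^] (n::nat) = \<zero> \<Longrightarrow> x = \<zero>"
  by (induction n) (auto simp: integral_iff)

lemma (in domain) frobenius_inj:
  assumes "x \<in> carrier R" "y \<in> carrier R" "x [^] (charexp ^ e) = y [^] (charexp ^ e)"
  shows "x = y"
proof -
  interpret frob: ring_hom_ring R R "\<lambda>x. x [^] (charexp ^ e)" by (rule frobenius_hom)
  have "(x \<ominus> y) [^] (charexp ^ e) = \<zero>"
    using assms by (simp add: minus_eq frob.hom_add frob.hom_a_inv del: frob.hom_a_inv) (simp add: r_neg)
  then have "x \<ominus> y = \<zero>"
    using assms nat_pow_zero_imp_zero minus_closed by blast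
  then show ?thesis using assms by simp
qed

section \<open>Minimal polynomials and roots\<close>

text \<open>\<open>Irr K x\<close> divides every polynomial over \<open>K\<close> that vanishes at
  \<open>x\<close>, so its roots, the conjugates of \<open>x\<close>, are roots of that polynomial
  too.\<close>

lemma (in domain) eval_conjugate_eq_zero:
  assumes "subfield K R" "x \<in> carrier R" "(algebraic over K) x"
    and "p \<in> carrier (K[X])" "eval p x = \<zero>" "y \<in> carrier R" "eval (Irr K x) y = \<zero>"
  shows "eval p y = \<zero>"
  using pdivides_imp_root_sharing[OF carrier_polynomial_shell[OF subfieldE(1)[OF assms(1)] IrrE(1)[OF assms(1-3)]]
    Irr_minimal[OF assms(1-5)] assms(6,7)] .

lemma (in domain) Irr_degree_le:
  assumes "subfield K R" "x \<in> carrier R" "(algebraic over K) x"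
    and "p \<in> carrier (K[X])" "p \<noteq> []" "eval p x = \<zero>"
  shows "degree (Irr K x) \<le> degree p"
  using pdivides_imp_degree_le[OF subfieldE(1)[OF assms(1)] IrrE(1)[OF assms(1-3)] assms(4,5)]
    Irr_minimal[OF assms(1-4,6)] by simp

lemma (in domain) Irr_unique:
  assumes "subfield K R" "x \<in> carrier R"
    and "p \<in> carrier (K[X])" "pirreducible K p" "lead_coeff p = \<one>" "eval p x = \<zero>"
  shows "(algebraic over K) x" "Irr K x = p"
proof -
  show alg: "(algebraic over K) x"
    using algebraicI[OF assms(3) _ assms(6)] pirreducibleE(1)[OF subfieldE(1)[OF assms(1)] assms(3,4)]
    by (simp add: over_def)
  show "Irr K x = p"
    using minimal_polynomial_is_unique[OF assms(1,2) alg] IrrE[OF assms(1,2) alg] assms(3-6)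
    by blast
qed

lemma (in domain) Irr_conjugate:
  assumes "subfield K R" "x \<in> carrier R" "(algebraic over K) x"
    and "y \<in> carrier R" "eval (Irr K x) y = \<zero>"
  shows "(algebraic over K) y" "Irr K y = Irr K x"
  using Irr_unique[OF assms(1,4) IrrE(1-3)[OF assms(1-3)] assms(5)] by auto

lemma (in domain) linear_poly_carrier:
  assumes "subring E R" "y \<in> E" shows "[\<one>, \<ominus> y] \<in> carrier (E[X])"
  using subringE(1-3,5)[OF assms(1)] assms(2) unfolding univ_poly_def polynomial_def by auto

lemma (in alg_closed_field) exists_root:
  assumes "p \<in> carrier (poly_ring R)" "degree p \<ge> 1"
  obtains y where "y \<in> carrier R" "eval p y = \<zero>"
proof -
  have "size (roots p) = degree p"
    using roots_over_carrier[OF assms(1)] unfolding splitted_def .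
  then have "roots p \<noteq> {#}" using assms(2) by auto
  then obtain y where "y \<in># roots p" by blast
  then show thesis
    using that roots_mem_iff_is_root[OF assms(1)] unfolding is_root_def by blast
qed

lemma (in domain) factor_root:
  assumes "p \<in> carrier (poly_ring R)" "p \<noteq> []" "y \<in> carrier R" "eval p y = \<zero>"
  obtains q where "q \<in> carrier (poly_ring R)" "q \<noteq> []" "p = [\<one>, \<ominus> y] \<otimes>\<^bsub>poly_ring R\<^esub> q"
    "length p = Suc (length q)" "lead_coeff q = lead_coeff p"
proof -
  have lin: "[\<one>, \<ominus> y] \<in> carrier (poly_ring R)"
    using linear_poly_carrier[OF carrier_is_subring assms(3)] .
  have "[\<one>, \<ominus> y] pdivides p"
    using is_root_imp_pdivides[OF assms(1)] assms unfolding is_root_def by blast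
  then obtain q where q: "q \<in> carrier (poly_ring R)" "p = [\<one>, \<ominus> y] \<otimes>\<^bsub>poly_ring R\<^esub> q"
    unfolding pdivides_def by (auto elim: dividesE)
  have nz: "q \<noteq> []"
    using q(2) assms(2) poly_mult_zero(2)[of "[\<one>, \<ominus> y]"] assms(3) unfolding univ_poly_mult by auto
  have pl: "polynomial (carrier R) [\<one>, \<ominus> y]" "polynomial (carrier R) q"
    using lin q(1) by (simp_all add: univ_poly_carrier)
  have "degree p = degree [\<one>, \<ominus> y] + degree q"
    using poly_mult_degree_eq[OF carrier_is_subring pl] nz q(2) unfolding univ_poly_mult by simp
  then have "length p = Suc (length q)"
    using nz assms(2) by (cases p; cases q) auto
  moreover have "lead_coeff p = lead_coeff q"
    using poly_mult_lead_coeff[OF carrier_is_subring pl] nz q polynomial_in_carrier[OF carrier_is_subring pl(2)]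
    unfolding univ_poly_mult by (cases q) auto
  ultimately show thesis using that[OF q(1) nz q(2)] by simp
qed

text \<open>Cancelling X - y turns (X - y)^2 | p into X - y | q. This links the multiplicity bound
  in \<open>separable_element\<close> to the value of a cofactor.\<close>

lemma (in domain) double_root_alg_mult:
  assumes "p \<in> carrier (poly_ring R)" "p \<noteq> []" "y \<in> carrier R"
   "q \<in> carrier (poly_ring R)" "p = [\<one>, \<ominus> y] \<otimes>\<^bsub>poly_ring R\<^esub> q"
  shows "eval q y = \<zero> \<longleftrightarrow> alg_mult p y \<ge> 2"
proof -
  interpret UP: domain "poly_ring R" using univ_poly_is_domain[OF carrier_is_subring] .
  have lin: "[\<one>, \<ominus> y] \<in> carrier (poly_ring R)"
    using linear_poly_carrier[OF carrier_is_subring assms(3)] .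
  have linz: "[\<one>, \<ominus> y] \<noteq> \<zero>\<^bsub>poly_ring R\<^esub>" by (simp add: univ_poly_zero)
  have nz: "q \<noteq> []"
    using assms(2,5) UP.r_null[OF lin] unfolding univ_poly_zero by auto
  have "eval q y = \<zero> \<longleftrightarrow> [\<one>, \<ominus> y] pdivides q"
    using is_root_imp_pdivides[OF assms(4)] pdivides_imp_is_root[OF nz assms(3)] assms(3) nz
    unfolding is_root_def by blast
  also have "\<dots> \<longleftrightarrow> ([\<one>, \<ominus> y] \<otimes>\<^bsub>poly_ring R\<^esub> [\<one>, \<ominus> y]) pdivides p"
    unfolding assms(5) pdivides_def
  proof
    assume "[\<one>, \<ominus> y] divides\<^bsub>poly_ring R\<^esub> q"
    then show "[\<one>, \<ominus> y] \<otimes>\<^bsub>poly_ring R\<^esub> [\<one>, \<ominus> y] divides\<^bsub>poly_ring R\<^esub> [\<one>, \<ominus> y] \<otimes>\<^bsub>poly_ring R\<^esub> q"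
      using UP.divides_mult_lI[OF _ lin lin] assms(4) by blast
  next
    assume "[\<one>, \<ominus> y] \<otimes>\<^bsub>poly_ring R\<^esub> [\<one>, \<ominus> y] divides\<^bsub>poly_ring R\<^esub> [\<one>, \<ominus> y] \<otimes>\<^bsub>poly_ring R\<^esub> q"
    then obtain c where c: "c \<in> carrier (poly_ring R)"
      "[\<one>, \<ominus> y] \<otimes>\<^bsub>poly_ring R\<^esub> q = [\<one>, \<ominus> y] \<otimes>\<^bsub>poly_ring R\<^esub> [\<one>, \<ominus> y] \<otimes>\<^bsub>poly_ring R\<^esub> c"
      by (auto elim: dividesE)
    then have "q = [\<one>, \<ominus> y] \<otimes>\<^bsub>poly_ring R\<^esub> c"
      using UP.m_lcancel[OF linz lin assms(4)] lin by (simp add: UP.m_assoc)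
    then show "[\<one>, \<ominus> y] divides\<^bsub>poly_ring R\<^esub> q" using c(1) by (auto simp: factor_def)
  qed
  also have "\<dots> \<longleftrightarrow> ([\<one>, \<ominus> y] [^]\<^bsub>poly_ring R\<^esub> (2::nat)) pdivides p"
    using lin by (simp add: numeral_2_eq_2)
  also have "\<dots> \<longleftrightarrow> alg_mult p y \<ge> 2"
    using alg_multE(2)[OF assms(3,1,2)] le_alg_mult_imp_pdivides[OF assms(3,1)] by blast
  finally show ?thesis .
qed

lemma (in domain) linear_mult_in_subring:
  assumes "subring E R" "y \<in> E" "q \<in> carrier (E[X])"
  shows "[\<one>, \<ominus> y] \<otimes>\<^bsub>poly_ring R\<^esub> q \<in> carrier (E[X])"
proof -
  interpret UP: ring "E[X]" using univ_poly_is_ring[OF assms(1)] .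
  show ?thesis
    using UP.m_closed[OF linear_poly_carrier[OF assms(1,2)] assms(3)] by (simp add: univ_poly_mult)
qed

text \<open>A monic polynomial over an algebraically closed field is a product of factors X - y, and
  here each of them has coefficients in \<open>E\<close>.\<close>

lemma (in alg_closed_field) monic_roots_in_subring:
  assumes "subring E R" "h \<in> carrier (poly_ring R)" "h \<noteq> []" "lead_coeff h = \<one>"
    and "\<And>y. y \<in> carrier R \<Longrightarrow> eval h y = \<zero> \<Longrightarrow> y \<in> E"
  shows "h \<in> carrier (E[X])"
  using assms(2-5)
proof (induction "length h" arbitrary: h rule: less_induct)
  case less
  show ?case
  proof (cases "degree h = 0")
    case True
    then have "h = [\<one>]" using less.prems(2,3) by (cases h) auto
    then show ?thesis
      using subringE(3)[OF assms(1)] unfolding univ_poly_def polynomial_def by simp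
  next
    case False
    then obtain y where y: "y \<in> carrier R" "eval h y = \<zero>"
      using exists_root[OF less.prems(1)] by (metis One_nat_def Suc_leI neq0_conv)
    obtain q where q: "q \<in> carrier (poly_ring R)" "q \<noteq> []" "h = [\<one>, \<ominus> y] \<otimes>\<^bsub>poly_ring R\<^esub> q"
        "length h = Suc (length q)" "lead_coeff q = lead_coeff h"
      using factor_root[OF less.prems(1,2) y] by blast
    have lin: "[\<one>, \<ominus> y] \<in> carrier (poly_ring R)"
      using linear_poly_carrier[OF carrier_is_subring y(1)] .
    have "q \<in> carrier (E[X])"
    proof (rule less.hyps)
      fix z assume z: "z \<in> carrier R" "eval q z = \<zero>"
      have "eval h z = eval [\<one>, \<ominus> y] z \<otimes> eval q z"
        unfolding q(3) using ring_hom_mult[OF eval_is_hom[OF carrier_is_subring z(1)] lin q(1)] .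
      then have "eval h z = \<zero>" using z y(1) by simp
      then show "z \<in> E" using less.prems(4) z(1) by blast
    qed (use q less.prems in auto)
    then show ?thesis
      using linear_mult_in_subring[OF assms(1) less.prems(4)[OF y]] q(3) by simp
  qed
qed

section \<open>Formal derivatives of coefficient lists\<close>

text \<open>Highest coefficient first; the result need not be normalized.\<close>

fun (in ring) deriv_coeffs :: "'a list \<Rightarrow> 'a list"
  where
    "deriv_coeffs [] = []"
  | "deriv_coeffs (a # p) = (if p = [] then [] else ([(length p)] \<cdot> a) # deriv_coeffs p)"

lemma (in ring) length_deriv_coeffs [simp]: "length (deriv_coeffs p) = length p - 1"
  by (induction p) auto

lemma (in ring) deriv_coeffs_in_subring:
  assumes "subring K R" shows "set p \<subseteq> K \<Longrightarrow> set (deriv_coeffs p) \<subseteq> K"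
proof (induction p)
  case (Cons a p)
  have "[n] \<cdot> a \<in> K" for n :: nat
    using Cons.prems subringE(2,7)[OF assms] by (induction n) (auto simp: add.nat_pow_Suc)
  then show ?case using Cons by auto
qed auto

lemma (in ring) eval_deriv_Cons:
  assumes "a \<in> carrier R" "set p \<subseteq> carrier R" "y \<in> carrier R"
  shows "eval (deriv_coeffs (a # p)) y = [(length p)] \<cdot> (a \<otimes> y [^] (length p - 1)) \<oplus> eval (deriv_coeffs p) y"
  using assms by (auto simp: add_pow_ldistr)

lemma (in ring) deriv_coeffs_closed: "set p \<subseteq> carrier R \<Longrightarrow> set (deriv_coeffs p) \<subseteq> carrier R"
  using deriv_coeffs_in_subring[OF carrier_is_subring] .

text \<open>Products of polynomials are normalized, whereas the derivative works on raw lists. A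
  stripped leading zero contributes only a multiple of \<open>\<zero>\<close>.\<close>

lemma (in ring) eval_deriv_normalize:
  assumes "y \<in> carrier R"
  shows "set p \<subseteq> carrier R \<Longrightarrow> eval (deriv_coeffs (normalize p)) y = eval (deriv_coeffs p) y"
proof (induction p)
  case (Cons a p)
  then show ?case
    using assms deriv_coeffs_closed[of p] eval_deriv_Cons[of a p y] eval_in_carrier[of "deriv_coeffs p" y] by auto
qed auto

lemma (in ring) eval_deriv_map2_add:
  assumes "y \<in> carrier R"
  shows "length p = length q \<Longrightarrow> set p \<subseteq> carrier R \<Longrightarrow> set q \<subseteq> carrier R \<Longrightarrow>
    eval (deriv_coeffs (map2 (\<oplus>) p q)) y = eval (deriv_coeffs p) y \<oplus> eval (deriv_coeffs q) y"
proof (induction p q rule: list_induct2')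
  case (4 a p b q)
  have c: "set (map2 (\<oplus>) p q) \<subseteq> carrier R"
    using 4 by (auto simp: set_zip in_set_conv_nth subset_iff)
  have e: "eval (deriv_coeffs p) y \<in> carrier R" "eval (deriv_coeffs q) y \<in> carrier R"
    using 4 assms deriv_coeffs_closed eval_in_carrier by auto
  show ?case
    using 4 c e assms by (simp add: eval_deriv_Cons add.nat_pow_distrib l_distr a_ac del: deriv_coeffs.simps)
qed auto

lemma (in cring) eval_deriv_scale:
  assumes "y \<in> carrier R" "c \<in> carrier R"
  shows "set p \<subseteq> carrier R \<Longrightarrow> eval (deriv_coeffs (map ((\<otimes>) c) p)) y = c \<otimes> eval (deriv_coeffs p) y"
proof (induction p)
  case (Cons a p)
  have c: "set (map ((\<otimes>) c) p) \<subseteq> carrier R" using Cons assms by auto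
  have e: "eval (deriv_coeffs p) y \<in> carrier R"
    using Cons assms deriv_coeffs_closed eval_in_carrier by auto
  show ?case
    using Cons c e assms by (simp add: eval_deriv_Cons add_pow_rdistr r_distr m_ac del: deriv_coeffs.simps)
qed (use assms in auto)

text \<open>Appending \<open>\<zero>\<close> multiplies by X, so this is the product rule (X p)' = X
  p' + p, evaluated at \<open>y\<close>.\<close>

lemma (in cring) eval_deriv_shift:
  assumes "y \<in> carrier R"
  shows "set p \<subseteq> carrier R \<Longrightarrow> eval (deriv_coeffs (p @ [\<zero>])) y = y \<otimes> eval (deriv_coeffs p) y \<oplus> eval p y"
proof (induction p)
  case (Cons a p)
  have c: "set (p @ [\<zero>]) \<subseteq> carrier R" "set p \<subseteq> carrier R" "a \<in> carrier R" using Cons assms by auto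
  have e: "eval (deriv_coeffs p) y \<in> carrier R" "eval p y \<in> carrier R"
    using Cons assms deriv_coeffs_closed eval_in_carrier by auto
  \<comment> \<open>For empty \<open>p\<close> the truncated exponent \<open>length p - 1\<close> is
    harmless: both sides are 0-fold multiples.\<close>
  have s: "y \<otimes> [(length p)] \<cdot> (a \<otimes> y [^] (length p - 1)) = [(length p)] \<cdot> (a \<otimes> y [^] length p)"
    using assms c by (cases "length p") (auto simp: add_pow_rdistr m_ac r_distr)
  have "eval (deriv_coeffs ((a # p) @ [\<zero>])) y
    = [(Suc (length p))] \<cdot> (a \<otimes> y [^] length p) \<oplus> (y \<otimes> eval (deriv_coeffs p) y \<oplus> eval p y)"
    using eval_deriv_Cons[OF c(3,1) assms] Cons by simp
  also have "\<dots> = y \<otimes> ([(length p)] \<cdot> (a \<otimes> y [^] (length p - 1)) \<oplus> eval (deriv_coeffs p) y)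
      \<oplus> (a \<otimes> y [^] length p \<oplus> eval p y)"
    using assms c e by (simp add: r_distr s[unfolded One_nat_def] a_ac)
  also have "\<dots> = y \<otimes> eval (deriv_coeffs (a # p)) y \<oplus> eval (a # p) y"
    using eval_deriv_Cons[OF c(3,2) assms] by simp
  finally show ?case .
qed (use assms in auto)

text \<open>In ((X - y) q)' = q + (X - y) q' the last term vanishes at \<open>y\<close>. A multiple
  root is therefore a root of the derivative.\<close>

lemma (in domain) eval_deriv_linear_mult:
  assumes y: "y \<in> carrier R" and q: "q \<in> carrier (poly_ring R)"
  shows "eval (deriv_coeffs ([\<one>, \<ominus> y] \<otimes>\<^bsub>poly_ring R\<^esub> q)) y = eval q y"
proof -
  have cq: "set q \<subseteq> carrier R"
    using q polynomial_in_carrier[OF carrier_is_subring] by (simp add: univ_poly_carrier)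
  \<comment> \<open>The list of -y q, padded by one leading zero to the length of
    \<open>q @ [\<zero>]\<close>, which stands for X q.\<close>
  let ?s = "\<zero> # map ((\<otimes>) (\<ominus> y)) q"
  have cs: "set ?s \<subseteq> carrier R" "set (map ((\<otimes>) (\<ominus> y)) q) \<subseteq> carrier R" using cq y by auto
  have "poly_mult [\<ominus> y] q = normalize (map ((\<otimes>) (\<ominus> y)) q)"
    using cs poly_add_zero'(1)[of "map ((\<otimes>) (\<ominus> y)) q"] by (simp del: poly_add.simps)
  then have "poly_mult [\<one>, \<ominus> y] q = poly_add (q @ [\<zero>]) (normalize (map ((\<otimes>) (\<ominus> y)) q))"
    using cq by (simp del: poly_add.simps add: map_idI subset_iff)
  also have "\<dots> = poly_add (q @ [\<zero>]) ?s"
    using poly_add_normalize(2)[of "q @ [\<zero>]" ?s] cs cq poly_add_normalize(2)[of "q @ [\<zero>]" "map ((\<otimes>) (\<ominus> y)) q"]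
    by (simp del: poly_add.simps)
  also have "\<dots> = normalize (map2 (\<oplus>) (q @ [\<zero>]) ?s)" by simp
  finally have m: "[\<one>, \<ominus> y] \<otimes>\<^bsub>poly_ring R\<^esub> q = normalize (map2 (\<oplus>) (q @ [\<zero>]) ?s)"
    unfolding univ_poly_mult .
  have c2: "set (map2 (\<oplus>) (q @ [\<zero>]) ?s) \<subseteq> carrier R"
  proof
    fix z assume "z \<in> set (map2 (\<oplus>) (q @ [\<zero>]) ?s)"
    then obtain a b where "z = a \<oplus> b" "(a, b) \<in> set (zip (q @ [\<zero>]) ?s)" by auto
    then show "z \<in> carrier R"
      using cq cs set_zip_leftD[of a b "q @ [\<zero>]" ?s] set_zip_rightD[of a b "q @ [\<zero>]" ?s] by auto
  qed
  have e: "eval (deriv_coeffs q) y \<in> carrier R" "eval q y \<in> carrier R"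
    using cq y deriv_coeffs_closed eval_in_carrier by auto
  have "eval (deriv_coeffs ([\<one>, \<ominus> y] \<otimes>\<^bsub>poly_ring R\<^esub> q)) y
     = eval (deriv_coeffs (q @ [\<zero>])) y \<oplus> eval (deriv_coeffs ?s) y"
    unfolding m eval_deriv_normalize[OF y c2] using cq cs y by (intro eval_deriv_map2_add) auto
  also have "eval (deriv_coeffs ?s) y = \<ominus> y \<otimes> eval (deriv_coeffs q) y"
    using eval_deriv_Cons[of \<zero> "map ((\<otimes>) (\<ominus> y)) q" y] cs y eval_deriv_scale[of y "\<ominus> y" q] cq e
    by (simp del: deriv_coeffs.simps)
  also have "eval (deriv_coeffs (q @ [\<zero>])) y \<oplus> \<ominus> y \<otimes> eval (deriv_coeffs q) y = eval q y"
    unfolding eval_deriv_shift[OF y cq] using y e by (simp add: l_minus a_ac r_neg1 r_neg)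
  finally show ?thesis .
qed

section \<open>Separability and p-th powers\<close>

text \<open>With zero coefficients off the multiples of \<open>d\<close>, f(z) is h(z^d), where
  \<open>h\<close> reads off every \<open>d\<close>-th coefficient. The induction on
  \<open>m\<close> adds one block of \<open>d\<close> coefficients at the top.\<close>

lemma (in ring) eval_sparse:
  assumes c: "\<And>i. c i \<in> carrier R" and z: "z \<in> carrier R" and d: "d > 0"
    and sparse: "\<And>i. \<not> d dvd i \<Longrightarrow> c i = \<zero>"
  shows "eval (map c (rev [0..<Suc (d * m)])) z
    = eval (map (\<lambda>j. c (d * j)) (rev [0..<Suc m])) (z [^] d)"
proof (induction m)
  case (Suc m)
  let ?l = "map c (rev [0..<Suc (d * m)])"
  obtain d' where d': "d = Suc d'" using d by (metis Suc_pred)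
  \<comment> \<open>Between two consecutive multiples of \<open>d\<close> lie
    \<open>d' = d - 1\<close> indices, whose coefficients all vanish.\<close>
  have "[0..<Suc (d * Suc m)] = [0..<Suc (d * m)] @ [Suc (d * m)..<d * Suc m] @ [d * Suc m]"
    using upt_add_eq_append[of 0 "Suc (d * m)" d'] upt_Suc_append[of "0" "d * Suc m"]
    by (simp add: d' ac_simps del: upt_Suc)
  then have l: "map c (rev [0..<Suc (d * Suc m)])
    = c (d * Suc m) # map c (rev [Suc (d * m)..<d * Suc m]) @ ?l"
    by (simp del: upt_Suc)
  have "map c (rev [Suc (d * m)..<d * Suc m]) = replicate d' \<zero>"
  proof (rule replicate_eqI)
    show "length (map c (rev [Suc (d * m)..<d * Suc m])) = d'" by (simp add: d')
    fix a assume "a \<in> set (map c (rev [Suc (d * m)..<d * Suc m]))"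
    then obtain i where i: "d * m < i" "i < d * Suc m" "a = c i"
      unfolding set_map set_rev set_upt by (auto simp del: mult_Suc_right simp: Suc_le_eq)
    have "\<not> d dvd i"
      using i(1,2) by (metis dvd_def nat_mult_less_cancel_disj not_less_eq)
    then show "a = \<zero>" using sparse i(3) by simp
  qed
  then have "eval (map c (rev [0..<Suc (d * Suc m)])) z
    = c (d * Suc m) \<otimes> z [^] (d' + Suc (d * m)) \<oplus> eval (replicate d' \<zero> @ ?l) z"
    unfolding l by (simp del: upt_Suc)
  also have "eval (replicate d' \<zero> @ ?l) z = eval ?l z"
    using c z by (intro eval_replicate) auto
  also have "d' + Suc (d * m) = d * Suc m" by (simp add: d')
  also have "z [^] (d * Suc m) = (z [^] d) [^] Suc m"
    using z by (simp only: nat_pow_pow)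
  finally show ?case unfolding Suc by simp
qed (use c z in simp)

lemma (in ring) sparse_poly:
  assumes E: "subring E R" and f: "f \<in> carrier (E[X])" and d: "d > 0" "degree f = d * m" "f \<noteq> []"
    and sparse: "\<And>i. \<not> d dvd i \<Longrightarrow> coeff f i = \<zero>"
  obtains h where "h \<in> carrier (E[X])" "length h = Suc m" "lead_coeff h = lead_coeff f"
    "\<And>z. z \<in> carrier R \<Longrightarrow> eval f z = eval h (z [^] d)"
proof -
  have fE: "set f \<subseteq> E" "set f \<subseteq> carrier R" "lead_coeff f \<noteq> \<zero>"
    using f d(3) subringE(1)[OF E] unfolding univ_poly_def polynomial_def by auto
  define h where "h = map (\<lambda>j. coeff f (d * j)) (rev [0..<Suc m])"
  have len: "length f = Suc (d * m)" using d by (cases f) auto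
  have c: "coeff f i \<in> E" for i
    using coeff_img_restrict[of f] coeff_length[of f i] fE(1) subringE(2)[OF E]
    by (cases "i < length f") (auto simp: subset_iff image_iff set_eq_iff)
  have hd: "lead_coeff h = lead_coeff f"
    unfolding h_def using lead_coeff_simp[OF d(3)] d(2) by simp
  have "set h \<subseteq> E" unfolding h_def using c by auto
  then have "h \<in> carrier (E[X])"
    using hd fE(3) unfolding univ_poly_def polynomial_def by auto
  moreover have "eval f z = eval h (z [^] d)" if "z \<in> carrier R" for z
    using eval_sparse[of "coeff f" z d m] that fE(2) d sparse coeff_list[of f] len unfolding h_def
    by (simp del: upt_Suc)
  ultimately show thesis using that[of h] hd by (simp add: h_def)
qed

text \<open>A multiple root of f = \<open>Irr K x\<close> is a root of f', which has smaller degree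
  than f and coefficients in \<open>K\<close>; so f' = 0. Then i c_i = 0 for every coefficient c_i,
  and only exponents divisible by the characteristic survive. As f is not constant, the
  characteristic is positive.\<close>

lemma (in alg_closed_field) inseparable_Irr:
  assumes K: "subfield K R" and x: "x \<in> carrier R" "(algebraic over K) x"
    and insep: "\<not> separable_element K x"
  obtains h where "charexp > 1" "h \<in> carrier (K[X])" "h \<noteq> []" "lead_coeff h = \<one>"
    "degree (Irr K x) = charexp * degree h" "degree h \<ge> 1"
    "\<And>z. z \<in> carrier R \<Longrightarrow> eval (Irr K x) z = eval h (z [^] charexp)"
proof -
  let ?f = "Irr K x"
  have KR: "subring K R" using subfieldE(1)[OF K] .
  note f = IrrE[OF K x]
  have fR: "?f \<in> carrier (poly_ring R)" using carrier_polynomial_shell[OF KR f(1)] .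
  have f0: "?f \<noteq> []" using pirreducibleE(1)[OF KR f(1,2)] .
  have deg: "degree ?f \<ge> 1" using pirreducible_degree[OF K f(1,2)] .
  have fK: "set ?f \<subseteq> K" "set ?f \<subseteq> carrier R"
    using f(1) subringE(1)[OF KR] unfolding univ_poly_def polynomial_def by auto
  obtain y where y: "y \<in> carrier R" "alg_mult ?f y \<ge> 2"
    using insep x(2) unfolding separable_element_def by (auto simp: not_le)
  have "eval ?f y = \<zero>"
    using alg_mult_gt_zero_iff_is_root[OF fR, of y] y(2) unfolding is_root_def by auto
  moreover from this obtain q where q: "q \<in> carrier (poly_ring R)"
      "?f = [\<one>, \<ominus> y] \<otimes>\<^bsub>poly_ring R\<^esub> q"
    using factor_root[OF fR f0 y(1)] by metis
  moreover have "eval q y = \<zero>"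
    using double_root_alg_mult[OF fR f0 y(1) q] y(2) by simp
  ultimately have dy: "eval (deriv_coeffs ?f) y = \<zero>" and fy: "eval ?f y = \<zero>"
    using eval_deriv_linear_mult[OF y(1) q(1)] by simp_all
  have dK: "set (deriv_coeffs ?f) \<subseteq> K" "set (deriv_coeffs ?f) \<subseteq> carrier R"
    using deriv_coeffs_in_subring[OF KR fK(1)] subringE(1)[OF KR] by auto
  \<comment> \<open>The multiple root \<open>y\<close> may differ from \<open>x\<close>, but it has
    the same minimal polynomial, and minimality is applied to \<open>y\<close>.\<close>
  have d0: "normalize (deriv_coeffs ?f) = []"
  proof (rule ccontr)
    assume nz: "normalize (deriv_coeffs ?f) \<noteq> []"
    have "normalize (deriv_coeffs ?f) \<in> carrier (K[X])"
      using normalize_gives_polynomial[OF dK(1)] by (simp add: univ_poly_carrier)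
    moreover have "eval (normalize (deriv_coeffs ?f)) y = \<zero>"
      using eval_normalize[OF dK(2) y(1)] dy by simp
    ultimately have "degree (Irr K y) \<le> degree (normalize (deriv_coeffs ?f))"
      using Irr_degree_le[OF K y(1) Irr_conjugate(1)[OF K x y(1) fy]] nz by simp
    also have "\<dots> < degree ?f"
      using normalize_length_le[of "deriv_coeffs ?f"] nz deg by (cases "normalize (deriv_coeffs ?f)") auto
    finally show False using Irr_conjugate(2)[OF K x y(1) fy] by simp
  qed
  have dcoeff: "coeff (deriv_coeffs p) i = [(Suc i)] \<cdot> coeff p (Suc i)" if "set p \<subseteq> carrier R" for p i
    using that
  proof (induction p)
    case (Cons a p)
    show ?case
    proof (cases "p = []")
      case False
      then have "i = length p - 1 \<longleftrightarrow> Suc i = length p" by (cases p) auto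
      then show ?thesis using Cons False by (auto simp del: add.nat_pow_Suc)
    qed simp
  qed simp
  have czero: "[(Suc i)] \<cdot> coeff ?f (Suc i) = \<zero>" for i
    using dcoeff[OF fK(2), of i] normalize_coeff[of "deriv_coeffs ?f"] d0 by (metis coeff.simps(1))
  have zero: "coeff ?f i = \<zero> \<or> i = 0 \<or> (charexp \<noteq> 1 \<and> charexp dvd i)" for i
  proof (cases i)
    case (Suc j)
    then show ?thesis
      using czero[of j] add_pow_eq_zero_iff[of "coeff ?f i" i] coeff_in_carrier[OF fK(2)]
        add_pow_one_eq_zero_iff[of i]
      by (auto simp del: add.nat_pow_Suc split: if_splits)
  qed simp
  have "coeff ?f (degree ?f) \<noteq> \<zero>" using f(3) lead_coeff_simp[OF f0] by simp
  then have p: "charexp \<noteq> 1" "charexp dvd degree ?f" using zero[of "degree ?f"] deg by auto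
  then obtain m where m: "degree ?f = charexp * m" by blast
  \<comment> \<open>Index 0, on which the derivative gives no information, is a multiple of
    \<open>charexp\<close> anyway.\<close>
  obtain h where h: "h \<in> carrier (K[X])" "length h = Suc m" "lead_coeff h = lead_coeff ?f"
    "\<And>z. z \<in> carrier R \<Longrightarrow> eval ?f z = eval h (z [^] charexp)"
    using sparse_poly[OF KR f(1) charexp_pos m f0] zero by (metis dvd_0_right)
  show thesis
  proof (rule that[of h])
    show "charexp > 1" using p(1) charexp_pos by linarith
    show "1 \<le> degree h" using h(2) m deg by (cases m) auto
  qed (use h f m in auto)
qed

text \<open>If f(X) = h(X^p) is the minimal polynomial of \<open>x\<close>, then \<open>h\<close>
  kills x^p, and its degree is smaller by the factor p > 1. This drop proves one half of the
  criterion below and makes the recursion in \<open>exists_separable_pow\<close> terminate.\<close>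

lemma (in alg_closed_field) inseparable_degree_pow_less:
  assumes K: "subfield K R" and x: "x \<in> carrier R" "(algebraic over K) x"
    and insep: "\<not> separable_element K x"
  shows "degree (Irr K (x [^] charexp)) < degree (Irr K x)"
proof -
  obtain h where h: "charexp > 1" "h \<in> carrier (K[X])" "h \<noteq> []" "lead_coeff h = \<one>"
    "degree (Irr K x) = charexp * degree h" "degree h \<ge> 1"
    "\<And>z. z \<in> carrier R \<Longrightarrow> eval (Irr K x) z = eval h (z [^] charexp)"
    using inseparable_Irr[OF assms] by metis
  have xp: "x [^] charexp \<in> carrier R" using x(1) by simp
  have "eval h (x [^] charexp) = \<zero>" using h(7)[OF x(1)] IrrE(4)[OF K x] by simp
  then have "degree (Irr K (x [^] charexp)) \<le> degree h"
    using Irr_degree_le[OF K xp _ h(2,3)] algebraicI[OF h(2,3)] by (simp add: over_def)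
  also have "\<dots> < degree (Irr K x)" using h(1,5,6) by simp
  finally show ?thesis .
qed

lemma (in domain) algebraic_nat_pow:
  assumes K: "subfield K R" and x: "x \<in> carrier R" "(algebraic over K) x"
  shows "(algebraic over K) (x [^] (n::nat))" "x [^] n \<in> simple_extension K x"
proof -
  show p: "x [^] n \<in> simple_extension K x"
    using subring_pow_closed[OF simple_extension_is_subring[OF subfieldE(1)[OF K] x(1)]
        simple_extension_mem[OF subfieldE(1)[OF K] x(1)]] .
  show "(algebraic over K) (x [^] n)"
    using simple_extesion_mem_imp_algebraic[OF K x p] .
qed

lemma (in domain) Irr_degree_one_imp_mem:
  assumes E: "subfield E R" and x: "x \<in> carrier R" "(algebraic over E) x"
    and deg: "degree (Irr E x) = 1"
  shows "x \<in> E"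
proof -
  note g = IrrE[OF E x]
  have ER: "subring E R" using subfieldE(1)[OF E] .
  obtain a b where ab: "Irr E x = [a, b]" "a \<in> E" "b \<in> E"
    using degree_oneE[OF g(1) deg] by metis
  have b: "b \<in> carrier R" using ab(3) subringE(1)[OF ER] by blast
  have "x \<oplus> b = \<zero>" using g(3,4) ab x(1) b by simp
  then have "x = \<ominus> b" using x(1) b by (metis minus_equality minus_minus a_inv_closed a_comm)
  then show "x \<in> E" using subringE(5)[OF ER] ab(3) by simp
qed

lemma (in ring) eval_pow_minus_const:
  assumes "a \<in> carrier R" "z \<in> carrier R" "(N::nat) > 0"
  shows "eval (\<one> # replicate (N - 1) \<zero> @ [\<ominus> a]) z = z [^] N \<ominus> a"
  using assms eval_replicate[of "[\<ominus> a]" z "N - 1"] by (simp add: minus_eq)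

lemma (in ring) pow_minus_const_closed:
  assumes "subring E R" "a \<in> E" "\<one> \<noteq> \<zero>"
  shows "\<one> # replicate m \<zero> @ [\<ominus> a] \<in> carrier (E[X])"
  using subringE(2,3)[OF assms(1)] subringE(5)[OF assms(1,2)] assms(3)
  unfolding univ_poly_def polynomial_def by auto

text \<open>X^N - x^N has coefficients in \<open>E\<close> and vanishes at \<open>x\<close>, hence
  at all conjugates. When \<open>N\<close> is a power of \<open>charexp\<close>, injectivity of
  Frobenius then yields \<open>y = x\<close>.\<close>

lemma (in domain) conjugate_pow_eq:
  assumes E: "subfield E R" and x: "x \<in> carrier R" "(algebraic over E) x"
    and N: "(N::nat) > 0" "x [^] N \<in> E"
    and y: "y \<in> carrier R" "eval (Irr E x) y = \<zero>"
  shows "y [^] N = x [^] N"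
proof -
  let ?m = "\<one> # replicate (N - 1) \<zero> @ [\<ominus> (x [^] N)]"
  have m: "?m \<in> carrier (E[X])"
    using pow_minus_const_closed[OF subfieldE(1)[OF E] N(2)] by simp
  have "eval ?m x = \<zero>"
    using eval_pow_minus_const[of "x [^] N" x N] x(1) N(1) by (simp add: r_neg minus_eq)
  then have zero: "eval ?m y = \<zero>" using eval_conjugate_eq_zero[OF E x m _ y] by blast
  have "eval ?m y = y [^] N \<ominus> x [^] N"
    using x(1) y(1) N(1) by (intro eval_pow_minus_const) auto
  then have "y [^] N \<ominus> x [^] N = \<zero>" unfolding zero by (rule sym)
  then show ?thesis using x(1) y(1) by simp
qed

text \<open>Forward: over K(x^p) all conjugates of \<open>x\<close> have the same p-th power, so
  \<open>x\<close> is the only root of its minimal polynomial there. That polynomial divides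
  \<open>Irr K x\<close>, whose roots are simple, so it is linear. Backward: for inseparable
  \<open>x\<close> the degree of K(x^p) is below that of K(x), so it has no room for the independent
  powers of \<open>x\<close>.\<close>

lemma (in alg_closed_field) separable_iff_mem_simple_extension:
  assumes K: "subfield K R" and x: "x \<in> carrier R" "(algebraic over K) x"
  shows "separable_element K x \<longleftrightarrow> x \<in> simple_extension K (x [^] charexp)"
proof
  let ?E = "simple_extension K (x [^] charexp)"
  have xp: "x [^] charexp \<in> carrier R" "(algebraic over K) (x [^] charexp)"
    using x algebraic_nat_pow[OF K x] by auto
  have E: "subfield ?E R" "K \<subseteq> ?E" "x [^] charexp \<in> ?E"
    using simple_extension_is_subfield[OF K xp(1)] xp(2) simple_extension_incl[OF subfieldE(3)[OF K] xp(1)]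
      simple_extension_mem[OF subfieldE(1)[OF K] xp(1)] by auto
  have ER: "subring ?E R" using subfieldE(1)[OF E(1)] .
  {
    assume sep: "separable_element K x"
    have xE: "(algebraic over ?E) x" using algebraic_mono[OF E(2)] x(2) by (simp add: over_def)
    let ?g = "Irr ?E x"
    note g = IrrE[OF E(1) x(1) xE]
    have gR: "?g \<in> carrier (poly_ring R)" using carrier_polynomial_shell[OF ER g(1)] .
    have g0: "?g \<noteq> []" using pirreducibleE(1)[OF ER g(1,2)] .
    have deg: "degree ?g \<ge> 1" using pirreducible_degree[OF E(1) g(1,2)] .
    note f = IrrE[OF K x]
    have fE: "Irr K x \<in> carrier (?E[X])" using f(1) E(2) unfolding univ_poly_def polynomial_def by auto
    have fR: "Irr K x \<in> carrier (poly_ring R)" using carrier_polynomial_shell[OF subfieldE(1)[OF K] f(1)] .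
    have f0: "Irr K x \<noteq> []" using pirreducibleE(1)[OF subfieldE(1)[OF K] f(1,2)] .
    have gf: "?g pdivides Irr K x" using Irr_minimal[OF E(1) x(1) xE fE f(4)] .
    obtain q where q: "q \<in> carrier (poly_ring R)" "q \<noteq> []" "?g = [\<one>, \<ominus> x] \<otimes>\<^bsub>poly_ring R\<^esub> q"
        "length ?g = Suc (length q)"
      using factor_root[OF gR g0 x(1) g(4)] by metis
    have "degree ?g = 1"
    proof (rule ccontr)
      assume "degree ?g \<noteq> 1"
      then have "degree q \<ge> 1" using q(4) deg by simp
      then obtain y where y: "y \<in> carrier R" "eval q y = \<zero>" using exists_root[OF q(1)] by blast
      have lin: "[\<one>, \<ominus> x] \<in> carrier (poly_ring R)"
        using linear_poly_carrier[OF carrier_is_subring x(1)] .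
      have "eval ?g y = \<zero>"
        using ring_hom_mult[OF eval_is_hom[OF carrier_is_subring y(1)] lin q(1)] y q(3) x(1) by simp
      then have "y [^] charexp = x [^] charexp"
        using conjugate_pow_eq[OF E(1) x(1) xE charexp_pos E(3) y(1)] by simp
      then have "y = x" using frobenius_inj[of y x 1] x(1) y(1) by simp
      then have "alg_mult ?g x \<ge> 2"
        using double_root_alg_mult[OF gR g0 x(1) q(1,3)] y(2) by simp
      then have "alg_mult (Irr K x) x \<ge> 2"
        using mset_subset_eq_count[OF pdivides_imp_roots_incl[OF gR fR f0 gf], of x]
        by (simp flip: alg_mult_eq_count_roots[OF gR] alg_mult_eq_count_roots[OF fR])
      then show False using sep x(1) unfolding separable_element_def by auto
    qed
    then show "x \<in> ?E" using Irr_degree_one_imp_mem[OF E(1) x(1) xE] by simp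
  }
  assume mem: "x \<in> ?E"
  show "separable_element K x"
  proof (rule ccontr)
    assume "\<not> separable_element K x"
    then have less: "degree (Irr K (x [^] charexp)) < degree (Irr K x)"
      using inseparable_degree_pow_less[OF K x] by simp
    have "length (exp_base x (degree (Irr K x))) \<le> degree (Irr K (x [^] charexp))"
    proof (rule independent_length_le_dimension[OF K dimension_simple_extension[OF K xp]])
      show "independent K (exp_base x (degree (Irr K x)))" using exp_base_independent[OF K x] .
      have "x [^] n \<in> ?E" for n :: nat using subring_pow_closed[OF ER mem] .
      then show "set (exp_base x (degree (Irr K x))) \<subseteq> ?E" unfolding exp_base_def by auto
    qed
    then show False using less by (simp add: exp_base_def)
  qed
qed

section \<open>Linear disjointness\<close>

text \<open>Each nonzero \<open>v\<close> in \<open>V\<close> is algebraic over \<open>I\<close>, so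
  its inverse already lies in the field I(v), which the ring \<open>V\<close> contains.\<close>

lemma (in domain) subring_finite_dimension_is_subfield:
  assumes I: "subfield I R" and V: "subring V R" "I \<subseteq> V" "finite_dimension I V"
  shows "subfield V R"
proof -
  have "subcring V R"
    using V(1) m_comm subringE(1)[OF V(1)] by (intro subcringI) auto
  then show ?thesis
  proof (rule subfieldI)
    interpret VR: domain "R \<lparr> carrier := V \<rparr>" using subring_is_domain[OF V(1)] .
    show "Units (R \<lparr> carrier := V \<rparr>) = V - {\<zero>}"
    proof
      show "Units (R \<lparr> carrier := V \<rparr>) \<subseteq> V - {\<zero>}"
        using VR.Units_closed VR.zero_not_one subringE(1)[OF V(1)] unfolding Units_def by auto
      show "V - {\<zero>} \<subseteq> Units (R \<lparr> carrier := V \<rparr>)"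
      proof
        fix v assume v: "v \<in> V - {\<zero>}"
        then have vR: "v \<in> carrier R" using subringE(1)[OF V(1)] by auto
        have "(algebraic over I) v"
          using finite_dimension_imp_algebraic[OF I V(1,3)] v by blast
        then have S: "subfield (simple_extension I v) R"
          using simple_extension_is_subfield[OF I vR] by simp
        have "inv v \<in> simple_extension I v" "v \<otimes> inv v = \<one>" "inv v \<otimes> v = \<one>"
          using subfield_m_inv[OF S, of v] simple_extension_mem[OF subfieldE(1)[OF I] vR] v by auto
        then show "v \<in> Units (R \<lparr> carrier := V \<rparr>)"
          using simple_extension_subring_incl[OF V(1,2), of v] v unfolding Units_def by auto
      qed
    qed
  qed
qed

lemma (in ring) finite_dimension_base:
  assumes "subfield K R" "finite_dimension K E"
  obtains Us where "set Us \<subseteq> carrier R" "independent K Us" "Span K Us = E" "length Us = (dim over K) E"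
  using exists_base[OF assms(1) finite_dimensionE[OF assms]] by blast

lemma (in ring) subfield_is_subalgebra:
  assumes "subfield E R" "K \<subseteq> E" shows "subalgebra K E R"
  unfolding subalgebra_def subalgebra_axioms_def
  using subringE(6)[OF subfieldE(1)[OF assms(1)]] assms(2)
    subring.axioms(1)[OF subfieldE(1)[OF assms(1)]] by auto

lemma (in ring) Span_mono_subfield:
  assumes "subfield K R" "subfield I R" "K \<subseteq> I" "set Us \<subseteq> carrier R"
  shows "Span K Us \<subseteq> Span I Us"
  using Span_eq_combine_set[OF assms(1,4)] Span_eq_combine_set[OF assms(2,4)] assms(3) by blast

text \<open>A \<open>subalgebra\<close> is merely a \<open>K\<close>-subspace. Such preimages allow
  closure of a span under multiplication to be tested on spanning elements, one factor at a
  time.\<close>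

lemma (in cring) mult_preimage_subalgebra:
  assumes K: "subfield K R" and V: "subalgebra K V R" and z: "z \<in> carrier R"
  shows "subalgebra K {v \<in> carrier R. z \<otimes> v \<in> V} R"
proof -
  interpret V: subalgebra K V R by fact
  have VR: "V \<subseteq> carrier R" using subalgebra_in_carrier[OF V] .
  have "subgroup {v \<in> carrier R. z \<otimes> v \<in> V} (add_monoid R)"
    using z V.one_closed V.m_closed V.m_inv_closed
    by (intro add.subgroupI) (auto simp: r_distr r_minus a_inv_def[symmetric])
  moreover have "z \<otimes> (k \<otimes> v) \<in> V" if "k \<in> K" "v \<in> carrier R" "z \<otimes> v \<in> V" for k v
    using V.smult_closed[OF that(1,3)] that z subfieldE(3)[OF K] by (auto simp: m_lcomm subset_iff)
  ultimately show ?thesis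
    unfolding subalgebra_def subalgebra_axioms_def using subfieldE(3)[OF K] by auto
qed

lemma (in cring) Span_is_subring:
  assumes K: "subfield K R" and Us: "set Us \<subseteq> carrier R" and one: "\<one> \<in> Span K Us"
    and mult: "\<And>u v. u \<in> set Us \<Longrightarrow> v \<in> set Us \<Longrightarrow> u \<otimes> v \<in> Span K Us"
  shows "subring (Span K Us) R" "K \<subseteq> Span K Us"
proof -
  note alg = Span_is_subalgebra[OF K Us]
  have 1: "u \<otimes> w \<in> Span K Us" if "u \<in> set Us" "w \<in> Span K Us" for u w
    using subalgebra_Span_incl[OF K mult_preimage_subalgebra[OF K alg, of u], of Us] that mult Us by blast
  have 2: "v \<otimes> w \<in> Span K Us" if "v \<in> Span K Us" "w \<in> Span K Us" for v w
  proof -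
    have w: "w \<in> carrier R" using that(2) Span_subgroup_props(1)[OF K Us] by blast
    have "w \<otimes> u \<in> Span K Us" "u \<in> carrier R" if "u \<in> set Us" for u
      using 1[OF that \<open>w \<in> Span K Us\<close>] m_comm[of w u] w Us that by auto
    then have "Span K Us \<subseteq> {v \<in> carrier R. w \<otimes> v \<in> Span K Us}"
      by (intro subalgebra_Span_incl[OF K mult_preimage_subalgebra[OF K alg w]]) blast
    then have "v \<in> carrier R" "w \<otimes> v \<in> Span K Us" using that(1) by auto
    then show ?thesis using w by (simp add: m_comm)
  qed
  show "subring (Span K Us) R"
    using Span_subgroup_props[OF K Us] one 2 by (intro subringI) auto
  show "K \<subseteq> Span K Us"
    using Span_smult_closed[OF K Us _ one] subfieldE(3)[OF K] by force
qed

text \<open>A dependent list spans a space of dimension strictly below its length. The dichotomy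
  inside is this fact in a form fit for induction; uniqueness of the dimension then excludes its
  second case.\<close>

lemma (in ring) spanning_list_independent:
  assumes K: "subfield K R" and Us: "set Us \<subseteq> carrier R"
    and dim: "dimension (length Us) K (Span K Us)"
  shows "independent K Us"
proof -
  have "independent K Us \<or> (\<exists>m < length Us. dimension m K (Span K Us))"
    using Us
  proof (induction Us)
    case (Cons u Us)
    then have Us: "set Us \<subseteq> carrier R" "u \<in> carrier R" by auto
    obtain m where m: "dimension m K (Span K Us)" "m \<le> length Us"
      using Cons dimension_independent[of K Us] by (auto intro: less_imp_le)
    show ?case
    proof (cases "u \<in> Span K Us")
      case True
      then have "Span K (u # Us) = Span K Us"
        using Span_base_incl[OF K Us(1)] mono_Span_subset[OF K, of "u # Us" Us] mono_Span[OF K Us] Us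
        by auto
      then show ?thesis using m by (metis length_Cons less_Suc_eq_le)
    next
      case False
      then show ?thesis
        using Cons.IH[OF Us(1)] li_Cons[OF Us(2) False] Suc_dim[OF Us(2) False] by auto
    qed
  qed simp
  then show ?thesis using dimension_is_inj[OF K dim] by auto
qed

lemma (in field) compositum_subfields:
  assumes "subfield E R" "subfield I R"
  shows "subfield (compositum E I) R" "E \<subseteq> compositum E I" "I \<subseteq> compositum E I"
    "\<And>M. subfield M R \<Longrightarrow> E \<subseteq> M \<Longrightarrow> I \<subseteq> M \<Longrightarrow> compositum E I \<subseteq> M"
  unfolding compositum_def
  using generate_fieldE[of "E \<union> I" "generate_field R (E \<union> I)"] subfieldE(3)[OF assms(1)] subfieldE(3)[OF assms(2)]
  by auto

text \<open>The products of members of \<open>Us\<close> lie in \<open>E\<close>, hence in the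
  \<open>I\<close>-span of \<open>Us\<close>. So this span is a ring, finite-dimensional over the
  field \<open>I\<close>, and thus a field containing both \<open>E\<close> and
  \<open>I\<close>.\<close>

lemma (in field) compositum_eq_Span:
  assumes K: "subfield K R" and E: "subfield E R" and I: "subfield I R" "K \<subseteq> I"
    and Us: "set Us \<subseteq> carrier R" "Span K Us = E"
  shows "compositum E I = Span I Us"
proof -
  have UE: "set Us \<subseteq> E" using Span_base_incl[OF K Us(1)] Us(2) by simp
  have ES: "E \<subseteq> Span I Us" using Span_mono_subfield[OF K I Us(1)] Us(2) by simp
  have sub: "subring (Span I Us) R" "I \<subseteq> Span I Us"
    using Span_is_subring[OF I(1) Us(1)] UE ES subringE(3,6)[OF subfieldE(1)[OF E]] by blast+
  have "subfield (Span I Us) R"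
    using subring_finite_dimension_is_subfield[OF I(1) sub Span_finite_dimension[OF I(1) Us(1)]] .
  then have "compositum E I \<subseteq> Span I Us"
    using compositum_subfields(4)[OF E I(1)] ES sub(2) by blast
  moreover have "Span I Us \<subseteq> compositum E I"
  proof (rule subalgebra_Span_incl[OF I(1)])
    note c = compositum_subfields(1-3)[OF E I(1)]
    show "subalgebra I (compositum E I) R" using subfield_is_subalgebra[OF c(1,3)] .
    show "set Us \<subseteq> compositum E I" using UE c(2) by blast
  qed
  ultimately show ?thesis by blast
qed

section \<open>Frobenius and linear independence\<close>

text \<open>The span of the p-th powers of \<open>Us\<close> contains the p-th power of every
  element of \<open>E\<close>, and so it is a ring. It contains each s in \<open>S\<close> because s
  lies in K(s^p). The condition \<open>gen\<close> speaks of subrings since that is what the span is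
  known to be at this point.\<close>

lemma (in alg_closed_field) Span_frobenius_base:
  assumes K: "subfield K R" and E: "subfield E R"
    and Us: "set Us \<subseteq> carrier R" "Span K Us = E"
    and S: "S \<subseteq> E" "\<And>x. x \<in> S \<Longrightarrow> separable_element K x"
    and gen: "\<And>V. subring V R \<Longrightarrow> K \<subseteq> V \<Longrightarrow> S \<subseteq> V \<Longrightarrow> E \<subseteq> V"
  shows "Span K (map (\<lambda>x. x [^] charexp) Us) = E"
proof -
  interpret frob: ring_hom_ring R R "\<lambda>x. x [^] charexp" using frobenius_hom[of 1] by simp
  let ?Vs = "map (\<lambda>x. x [^] charexp) Us"
  have ER: "subring E R" using subfieldE(1)[OF E] .
  have powE: "x [^] n \<in> E" if "x \<in> E" for x and n :: nat
    using subring_pow_closed[OF ER that] .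
  have UE: "set Us \<subseteq> E" using Span_base_incl[OF K Us(1)] Us(2) by simp
  have KE: "K \<subseteq> E"
  proof -
    have "k \<otimes> \<one> \<in> E" if "k \<in> K" for k
      using Span_smult_closed[OF K Us(1) that] subringE(3)[OF ER] Us(2) by blast
    then show ?thesis using subfieldE(3)[OF K] by force
  qed
  have Vs: "set ?Vs \<subseteq> carrier R" "set ?Vs \<subseteq> E" using Us(1) UE powE by auto
  have pow: "x [^] charexp \<in> Span K ?Vs" if "x \<in> E" for x
  proof -
    obtain Ks where Ks: "set Ks \<subseteq> K" "x = combine Ks Us"
      using \<open>x \<in> E\<close> Span_eq_combine_set[OF K Us(1)] Us(2) by blast
    have "x [^] charexp = combine (map (\<lambda>x. x [^] charexp) Ks) ?Vs"
      using frob.combine_hom[of Ks Us] Ks Us(1) subfieldE(3)[OF K] by auto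
    moreover have "set (map (\<lambda>x. x [^] charexp) Ks) \<subseteq> K"
    proof -
      have "x [^] n \<in> K" if "x \<in> K" for x and n :: nat
        using subring_pow_closed[OF subfieldE(1)[OF K] that] .
      then show ?thesis using Ks(1) by auto
    qed
    ultimately show ?thesis using Span_eq_combine_set[OF K Vs(1)] by blast
  qed
  have sub: "subring (Span K ?Vs) R" "K \<subseteq> Span K ?Vs"
  proof -
    have 1: "\<one> \<in> Span K ?Vs" using pow[OF subringE(3)[OF ER]] by simp
    have 2: "u \<otimes> v \<in> Span K ?Vs" if uv: "u \<in> set ?Vs" "v \<in> set ?Vs" for u v
    proof -
      obtain a b where ab: "a \<in> set Us" "b \<in> set Us" "u = a [^] charexp" "v = b [^] charexp"
        using uv by auto
      then have "u \<otimes> v = (a \<otimes> b) [^] charexp" using Us(1) by (auto simp: nat_pow_distrib subset_iff)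
      moreover have "a \<otimes> b \<in> E" using ab UE subringE(6)[OF ER] by auto
      ultimately show ?thesis using pow by simp
    qed
    show "subring (Span K ?Vs) R" "K \<subseteq> Span K ?Vs"
      using Span_is_subring[OF K Vs(1) 1 2] by blast+
  qed
  have "S \<subseteq> Span K ?Vs"
  proof
    fix x assume x: "x \<in> S"
    then have xE: "x \<in> E" "x \<in> carrier R" using S(1) subringE(1)[OF ER] by auto
    have "x \<in> simple_extension K (x [^] charexp)"
      using separable_iff_mem_simple_extension[OF K xE(2)] S(2)[OF x] unfolding separable_element_def by blast
    then show "x \<in> Span K ?Vs"
      using simple_extension_subring_incl[OF sub pow[OF xE(1)]] by blast
  qed
  then have "E \<subseteq> Span K ?Vs" using gen sub by blast
  moreover have "Span K ?Vs \<subseteq> E" using mono_Span_subset[OF K _ Us(1), of ?Vs] Vs Us(2) by simp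
  ultimately show ?thesis by blast
qed

lemma (in alg_closed_field) frobenius_independent:
  assumes K: "subfield K R" and E: "subfield E R" "finite_dimension K E"
    and S: "S \<subseteq> E" "\<And>x. x \<in> S \<Longrightarrow> separable_element K x"
    and gen: "\<And>V. subring V R \<Longrightarrow> K \<subseteq> V \<Longrightarrow> S \<subseteq> V \<Longrightarrow> E \<subseteq> V"
    and Us: "independent K Us" "set Us \<subseteq> E"
  shows "independent K (map (\<lambda>x. x [^] (charexp ^ e)) Us)"
proof -
  let ?n = "(dim over K) E"
  have dimE: "dimension ?n K E" using finite_dimensionE[OF K E(2)] .
  have powE: "x [^] n \<in> E" if "x \<in> E" for x and n :: nat
    using subring_pow_closed[OF subfieldE(1)[OF E(1)] that] .
  have step: "independent K (map (\<lambda>x. x [^] charexp) Us)" if Us: "independent K Us" "set Us \<subseteq> E" for Us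
  proof -
    \<comment> \<open>Completion to a basis makes counting possible: n elements spanning the
      n-dimensional \<open>E\<close> are independent.\<close>
    obtain Ws where Ws: "length (Ws @ Us) = ?n" "independent K (Ws @ Us)" "Span K (Ws @ Us) = E"
      using complete_base[OF K dimE Us] by blast
    have c: "set (Ws @ Us) \<subseteq> carrier R" using independent_in_carrier[OF Ws(2)] .
    then have "independent K (map (\<lambda>x. x [^] charexp) (Ws @ Us))"
      using spanning_list_independent[OF K, of "map (\<lambda>x. x [^] charexp) (Ws @ Us)"]
        Span_frobenius_base[OF K E(1) c Ws(3) S gen] Ws(1) dimE by auto
    then show ?thesis
      using independent_split(1)[OF K] by (metis map_append)
  qed
  show ?thesis
  proof (induction e)
    case 0
    have "map (\<lambda>x. x [^] (charexp ^ 0)) Us = Us"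
      using Us(2) subfieldE(3)[OF E(1)] by (intro map_idI) auto
    then show ?case using Us(1) by simp
  next
    case (Suc e)
    have eq: "map (\<lambda>x. x [^] (charexp ^ Suc e)) Us
       = map (\<lambda>x. x [^] charexp) (map (\<lambda>x. x [^] (charexp ^ e)) Us)"
      using Us(2) subfieldE(3)[OF E(1)] by (auto simp: nat_pow_pow mult.commute subset_iff)
    have "set (map (\<lambda>x. x [^] (charexp ^ e)) Us) \<subseteq> E" using Us(2) powE by auto
    then show ?case unfolding eq using step[OF Suc] by blast
  qed
qed

text \<open>With n the degree of \<open>z\<close>, the elements 1, z, ..., z^(n-1) are independent,
  hence so are their p-th powers, which are powers of z^p. Being n elements of the n-dimensional
  K(z), they span it, so \<open>z\<close> lies in K(z^p).\<close>

lemma (in alg_closed_field) separable_generated: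
  assumes K: "subfield K R" and E: "subfield E R" "K \<subseteq> E" "finite_dimension K E"
    and S: "S \<subseteq> E" "\<And>x. x \<in> S \<Longrightarrow> separable_element K x"
    and gen: "\<And>V. subring V R \<Longrightarrow> K \<subseteq> V \<Longrightarrow> S \<subseteq> V \<Longrightarrow> E \<subseteq> V"
    and z: "z \<in> E"
  shows "separable_element K z"
proof -
  have zR: "z \<in> carrier R" using z subfieldE(3)[OF E(1)] by blast
  have alg: "(algebraic over K) z"
    using finite_dimension_imp_algebraic[OF K subfieldE(1)[OF E(1)] E(3) z] .
  let ?n = "degree (Irr K z)" and ?w = "z [^] charexp"
  have w: "?w \<in> carrier R" using zR by simp
  have powE: "z [^] n \<in> E" for n :: nat
    using subring_pow_closed[OF subfieldE(1)[OF E(1)] z] .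
  have pz: "z [^] m \<in> simple_extension K z" for m :: nat using algebraic_nat_pow(2)[OF K zR alg] .
  have eq: "map (\<lambda>x. x [^] charexp) (exp_base z ?n) = exp_base ?w ?n"
    using zR by (auto simp: exp_base_def nat_pow_pow mult.commute)
  have ind: "independent K (exp_base ?w ?n)"
    using frobenius_independent[OF K E(1,3) S gen exp_base_independent[OF K zR alg], of 1] powE
    unfolding eq[symmetric] by (auto simp: exp_base_def)
  have "set (exp_base ?w ?n) \<subseteq> simple_extension K z"
    using zR pz by (auto simp: exp_base_def nat_pow_pow)
  then have "Span K (exp_base ?w ?n) = simple_extension K z"
    using independent_length_eq_dimension[OF K dimension_simple_extension[OF K zR alg] ind]
    by (simp add: exp_base_def)
  moreover have "Span K (exp_base ?w ?n) \<subseteq> simple_extension K ?w"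
    using Span_eq_eval_img[OF K w] simple_extension_as_eval_img[OF subfieldE(3)[OF K] w] by auto
  ultimately have "z \<in> simple_extension K ?w"
    using simple_extension_mem[OF subfieldE(1)[OF K] zR] by blast
  then show ?thesis using separable_iff_mem_simple_extension[OF K zR alg] by simp
qed

text \<open>Raising a linear relation to a high power of \<open>p\<close> moves its coefficients into \<open>K\<close>.\<close>

lemma (in alg_closed_field) separable_purely_inseparable_independent:
  assumes K: "subfield K R" and E: "subfield E R" "finite_dimension K E" "separable_extension K E"
    and I: "subfield I R" "purely_inseparable_extension K I"
    and Us: "independent K Us" "set Us \<subseteq> E"
  shows "independent I Us"
proof -
  have KR: "subring K R" using subfieldE(1)[OF K] .
  have powK: "x [^] n \<in> K" if "x \<in> K" for x and n :: nat
    using subring_pow_closed[OF KR that] .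
  have c: "set Us \<subseteq> carrier R" using independent_in_carrier[OF Us(1)] .
  \<comment> \<open>Once a p-power of k is in \<open>K\<close>, all later ones are, so finitely many
    coefficients share one exponent.\<close>
  have common: "\<exists>e. \<forall>k \<in> set Ks. k [^] (charexp ^ e) \<in> K" if "set Ks \<subseteq> I" for Ks
    using that
  proof (induction Ks)
    case (Cons k Ks)
    then obtain e n where en: "\<forall>k \<in> set Ks. k [^] (charexp ^ e) \<in> K" "k [^] (charexp ^ n) \<in> K"
      using I(2) unfolding purely_inseparable_extension_def by auto
    have up: "x [^] (charexp ^ (a + b)) \<in> K" if "x \<in> I" "x [^] (charexp ^ a) \<in> K" for x a b
      using powK[OF that(2), of "charexp ^ b"] that(1) subfieldE(3)[OF I(1)]
      by (auto simp: nat_pow_pow power_add subset_iff)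
    have "\<forall>k' \<in> set (k # Ks). k' [^] (charexp ^ (e + n)) \<in> K"
      using up[of _ e n] up[of k n e] en Cons.prems by (auto simp: add.commute)
    then show ?case by blast
  qed simp
  show ?thesis
  proof (rule trivial_combine_imp_independent[OF I(1) c])
    fix Ks assume Ks: "set Ks \<subseteq> I" "combine Ks Us = \<zero>"
    obtain e where e: "\<forall>k \<in> set Ks. k [^] (charexp ^ e) \<in> K" using common[OF Ks(1)] by blast
    interpret frob: ring_hom_ring R R "\<lambda>x. x [^] (charexp ^ e)" by (rule frobenius_hom)
    let ?f = "\<lambda>x. x [^] (charexp ^ e)"
    have KsR: "set Ks \<subseteq> carrier R" using Ks(1) subfieldE(3)[OF I(1)] by blast
    have "combine (map ?f Ks) (map ?f Us) = \<zero>"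
      using frob.combine_hom[OF KsR c] Ks(2) by simp
    moreover have "independent K (map ?f Us)"
      using E by (intro frobenius_independent[OF K E(1,2) _ _ _ Us, of E])
        (auto simp: separable_extension_def)
    ultimately have "set (take (length Us) (map ?f Ks)) \<subseteq> {\<zero>}"
      using independent_imp_trivial_combine[OF K, of "map ?f Us" "map ?f Ks"] e by auto
    then have "k [^] (charexp ^ e) = \<zero>" if "k \<in> set (take (length Us) Ks)" for k
      using that by (auto simp: take_map)
    then show "set (take (length Us) Ks) \<subseteq> {\<zero>}"
      using nat_pow_zero_imp_zero KsR set_take_subset[of "length Us" Ks] by blast
  qed
qed

text \<open>A \<open>K\<close>-basis of \<open>E\<close> remains independent over \<open>I\<close>
  and spans the compositum over \<open>I\<close>, so [EI : I] = [E : K]; the tower law over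
  \<open>I\<close> gives the rest.\<close>

lemma (in alg_closed_field) dim_compositum:
  assumes K: "subfield K R" and E: "subfield E R" "finite_dimension K E" "separable_extension K E"
    and I: "subfield I R" "K \<subseteq> I" "finite_dimension K I" "purely_inseparable_extension K I"
  shows "(dim over K) (compositum E I) = (dim over K) E * (dim over K) I"
    and "finite_dimension K (compositum E I)"
proof -
  obtain Us where Us: "set Us \<subseteq> carrier R" "independent K Us" "Span K Us = E" "length Us = (dim over K) E"
    using finite_dimension_base[OF K E(2)] by blast
  have "set Us \<subseteq> E" using Span_base_incl[OF K Us(1)] Us(3) by simp
  then have "independent I Us"
    using separable_purely_inseparable_independent[OF K E I(1,4) Us(2)] by simp
  then have "dimension ((dim over K) E) I (compositum E I)"
    using dimension_independent[of I Us] compositum_eq_Span[OF K E(1) I(1,2) Us(1,3)] Us(4) by simp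
  then have dim: "dimension ((dim over K) I * (dim over K) E) K (compositum E I)"
    using telescopic_base[OF K I(1) finite_dimensionE[OF K I(3)]] by blast
  show "(dim over K) (compositum E I) = (dim over K) E * (dim over K) I"
    using dimI[OF K dim] by simp
  show "finite_dimension K (compositum E I)" using finite_dimensionI[OF dim] .
qed

section \<open>Conjugates and normality\<close>

text \<open>The extension sends p(x) to the value at \<open>y\<close> of \<open>p\<close> with
  \<open>s\<close> applied to its coefficients. It is well defined: polynomials that agree at
  \<open>x\<close> differ by a multiple of \<open>Irr M x\<close>, whose image under
  \<open>s\<close> vanishes at \<open>y\<close>.\<close>

lemma (in field) extend_hom:
  assumes M: "subfield M R" and s: "s \<in> ring_hom (R \<lparr> carrier := M \<rparr>) R"
    and x: "x \<in> carrier R" "(algebraic over M) x"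
    and y: "y \<in> carrier R" "eval (map s (Irr M x)) y = \<zero>"
  obtains t where "t \<in> ring_hom (R \<lparr> carrier := simple_extension M x \<rparr>) R"
    "\<And>m. m \<in> M \<Longrightarrow> t m = s m" "t x = y"
proof -
  have MR: "subring M R" using subfieldE(1)[OF M] .
  interpret MM: ring "R \<lparr> carrier := M \<rparr>" using subring_is_ring[OF MR] .
  interpret h: ring_hom_ring "R \<lparr> carrier := M \<rparr>" R s
    using ring_hom_ringI2[OF MM.ring_axioms ring_axioms s] .
  interpret UP: domain "M[X]" using univ_poly_is_domain[OF MR] .
  define P where "P = (\<lambda>p. eval (map s p) y)"
  have set_M: "set p \<subseteq> M" if "p \<in> carrier (M[X])" for p
    using that unfolding univ_poly_def polynomial_def by auto
  have sM: "s m \<in> carrier R" if "m \<in> M" for m using h.hom_closed that by simp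
  have map_closed: "set (map s p) \<subseteq> carrier R" if "set p \<subseteq> M" for p using that sM by auto
  have P_closed: "P p \<in> carrier R" if "p \<in> carrier (M[X])" for p
    unfolding P_def using eval_in_carrier[OF map_closed[OF set_M[OF that]] y(1)] .
  have P_mult: "P (p \<otimes>\<^bsub>M[X]\<^esub> q) = P p \<otimes> P q" if "p \<in> carrier (M[X])" "q \<in> carrier (M[X])" for p q
  proof -
    have "normalize (map s (poly_mult p q)) = poly_mult (map s p) (map s q)"
      using h.poly_mult_hom'[of p q] set_M[OF that(1)] set_M[OF that(2)] by (simp add: poly_mult_consistent[OF MR])
    moreover have "set (map s (poly_mult p q)) \<subseteq> carrier R"
      using map_closed set_M[OF UP.m_closed[OF that]] by (simp add: univ_poly_mult)
    ultimately show ?thesis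
      unfolding P_def univ_poly_mult
      using eval_normalize[of "map s (poly_mult p q)" y] y(1)
        eval_poly_mult[of "map s p" "map s q" y] map_closed set_M that by metis
  qed
  have P_add: "P (p \<oplus>\<^bsub>M[X]\<^esub> q) = P p \<oplus> P q" if "p \<in> carrier (M[X])" "q \<in> carrier (M[X])" for p q
  proof -
    have "normalize (map s (poly_add p q)) = poly_add (map s p) (map s q)"
      using h.poly_add_hom'[of p q] set_M[OF that(1)] set_M[OF that(2)]
      by (simp add: poly_add_consistent[OF MR] del: poly_add.simps)
    moreover have "set (map s (poly_add p q)) \<subseteq> carrier R"
      using map_closed set_M[OF UP.a_closed[OF that]] by (simp add: univ_poly_add del: poly_add.simps)
    ultimately show ?thesis
      unfolding P_def univ_poly_add
      using eval_normalize[of "map s (poly_add p q)" y] y(1)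
        eval_poly_add[of "map s p" "map s q" y] map_closed set_M that by metis
  qed
  have ev: "(\<lambda>p. eval p x) \<in> ring_hom (M[X]) R" using eval_is_hom[OF MR x(1)] .
  interpret ev: ring_hom_ring "M[X]" R "\<lambda>p. eval p x" using eval_ring_hom[OF MR x(1)] .
  note f = IrrE[OF M x]
  have wd: "P p = P q" if pq: "p \<in> carrier (M[X])" "q \<in> carrier (M[X])" "eval p x = eval q x" for p q
  proof -
    have d: "p \<ominus>\<^bsub>M[X]\<^esub> q \<in> carrier (M[X])" using pq by simp
    have "eval (p \<ominus>\<^bsub>M[X]\<^esub> q) x = \<zero>"
      using pq ev.hom_closed by (simp add: a_minus_def r_neg)
    then have "Irr M x pdivides (p \<ominus>\<^bsub>M[X]\<^esub> q)" using Irr_minimal[OF M x d] by blast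
    then have "Irr M x divides\<^bsub>M[X]\<^esub> (p \<ominus>\<^bsub>M[X]\<^esub> q)" using pdivides_iff_shell[OF M f(1) d] by blast
    then obtain r where r: "r \<in> carrier (M[X])" "p \<ominus>\<^bsub>M[X]\<^esub> q = Irr M x \<otimes>\<^bsub>M[X]\<^esub> r"
      by (auto elim: dividesE)
    have "p = (p \<ominus>\<^bsub>M[X]\<^esub> q) \<oplus>\<^bsub>M[X]\<^esub> q"
      using pq(1,2) by (simp add: a_minus_def UP.a_assoc UP.l_neg)
    then have "P p = P (Irr M x) \<otimes> P r \<oplus> P q"
      using P_add[OF d pq(2)] P_mult[OF f(1) r(1)] r(2) by simp
    then show ?thesis using y P_closed r(1) pq(2) by (simp add: P_def)
  qed
  \<comment> \<open>An arbitrary polynomial representing z is chosen; by \<open>wd\<close> the value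
    does not depend on it.\<close>
  define t where "t = (\<lambda>z. P (SOME p. p \<in> carrier (M[X]) \<and> eval p x = z))"
  have t_eval: "t (eval p x) = P p" if "p \<in> carrier (M[X])" for p
  proof -
    let ?Q = "\<lambda>q. q \<in> carrier (M[X]) \<and> eval q x = eval p x"
    have "?Q (Eps ?Q)" using that someI[where P = ?Q and x = p] by blast
    then show ?thesis unfolding t_def using wd[OF _ that] by blast
  qed
  have img: "simple_extension M x = (\<lambda>p. eval p x) ` carrier (M[X])"
    using simple_extension_as_eval_img[OF subfieldE(3)[OF M] x(1)] .
  show thesis
  proof (rule that[of t])
    show "t \<in> ring_hom (R \<lparr> carrier := simple_extension M x \<rparr>) R"
    proof (rule ring_hom_memI)
      fix a b assume "a \<in> carrier (R \<lparr> carrier := simple_extension M x \<rparr>)"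
        "b \<in> carrier (R \<lparr> carrier := simple_extension M x \<rparr>)"
      then obtain p q where pq: "p \<in> carrier (M[X])" "a = eval p x" "q \<in> carrier (M[X])" "b = eval q x"
        using img by auto
      show "t a \<in> carrier R" using pq t_eval P_closed by simp
      show "t (a \<otimes>\<^bsub>R \<lparr> carrier := simple_extension M x \<rparr>\<^esub> b) = t a \<otimes> t b"
        using ring_hom_mult[OF ev pq(1,3)] t_eval[OF UP.m_closed[OF pq(1,3)]] t_eval pq P_mult by simp
      show "t (a \<oplus>\<^bsub>R \<lparr> carrier := simple_extension M x \<rparr>\<^esub> b) = t a \<oplus> t b"
        using ring_hom_add[OF ev pq(1,3)] t_eval[OF UP.a_closed[OF pq(1,3)]] t_eval pq P_add by simp
    next
      have "P \<one>\<^bsub>M[X]\<^esub> = \<one>"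
        using h.hom_one y(1) by (simp add: P_def univ_poly_one)
      then show "t \<one>\<^bsub>R \<lparr> carrier := simple_extension M x \<rparr>\<^esub> = \<one>"
        using ring_hom_one[OF ev] t_eval[OF UP.one_closed] by simp
    qed
    show "t m = s m" if m: "m \<in> M" for m
    proof -
      have c: "poly_of_const m \<in> carrier (M[X])"
        using m normalize_gives_polynomial[of "[m]" M] unfolding poly_of_const_def by (simp add: univ_poly_carrier)
      have "eval (poly_of_const m) x = m"
        using m x(1) subringE(1)[OF MR] eval_normalize[of "[m]" x] unfolding poly_of_const_def by auto
      moreover have "P (poly_of_const m) = s m"
        using m y(1) sM[OF m] h.hom_zero unfolding poly_of_const_def P_def by auto
      ultimately show ?thesis using t_eval[OF c] by simp
    qed
    have "P [\<one>, \<zero>] = y" using y(1) h.hom_one h.hom_zero by (simp add: P_def)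
    then show "t x = y"
      using t_eval[OF var_closed(1)[OF MR]] eval_var[OF x(1)] by (simp add: var_def)
  qed
qed

text \<open>The elements of \<open>xs\<close> are adjoined one at a time; algebraic closedness
  supplies a root of each transported minimal polynomial.\<close>

lemma (in alg_closed_field) extend_hom_finite:
  assumes M: "subfield M R" and s: "s \<in> ring_hom (R \<lparr> carrier := M \<rparr>) R"
    and xs: "set xs \<subseteq> carrier R" "\<And>x. x \<in> set xs \<Longrightarrow> (algebraic over M) x"
  shows "\<exists>t \<in> ring_hom (R \<lparr> carrier := finite_extension M xs \<rparr>) R. \<forall>m \<in> M. t m = s m"
  using xs
proof (induction xs)
  case Nil
  show ?case using s by (auto intro!: bexI[of _ s])
next
  case (Cons x xs)
  let ?M = "finite_extension M xs"
  obtain t where t: "t \<in> ring_hom (R \<lparr> carrier := ?M \<rparr>) R" "\<forall>m \<in> M. t m = s m"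
    using Cons by auto
  have xs: "set xs \<subseteq> carrier R" and x: "x \<in> carrier R" using Cons.prems by auto
  have E: "subfield ?M R" using finite_extension_is_subfield[OF M xs] Cons.prems(2) by simp
  have ME: "M \<subseteq> ?M" using finite_extension_incl[OF subfieldE(3)[OF M] xs] .
  have alg: "(algebraic over ?M) x"
    using algebraic_mono[OF ME, of x] Cons.prems(2) by (simp add: over_def)
  note f = IrrE[OF E x alg]
  have "Irr ?M x \<in> carrier (poly_ring (R \<lparr> carrier := ?M \<rparr>))"
    using f(1) univ_poly_consistent[OF subfieldE(1)[OF E]] by simp
  \<comment> \<open>A homomorphism of fields is injective, so the leading coefficient stays
    nonzero.\<close>
  then have "map t (Irr ?M x) \<in> carrier (poly_ring R)"
    using polynomial_hom[OF t(1) subfield_iff(2)[OF E] field_axioms] by blast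
  moreover have "degree (map t (Irr ?M x)) \<ge> 1" using pirreducible_degree[OF E f(1,2)] by simp
  ultimately obtain y where y: "y \<in> carrier R" "eval (map t (Irr ?M x)) y = \<zero>"
    using exists_root by blast
  obtain t' where "t' \<in> ring_hom (R \<lparr> carrier := simple_extension ?M x \<rparr>) R"
    "\<And>m. m \<in> ?M \<Longrightarrow> t' m = t m"
    using extend_hom[OF E t(1) x alg y] by blast
  then show ?case using t(2) ME by (intro bexI[of _ t']) auto
qed

text \<open>K(w) is mapped by sending \<open>w\<close> to \<open>z\<close>, and the map is then
  extended over \<open>xs\<close>. Finitely many extra elements are enough for closure of the normal
  core, where at most two are involved at a time.\<close>

lemma (in alg_closed_field) conjugate_hom:
  assumes K: "subfield K R" and w: "w \<in> carrier R" "(algebraic over K) w"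
    and z: "z \<in> carrier R" "eval (Irr K w) z = \<zero>"
    and xs: "set xs \<subseteq> carrier R" "\<And>x. x \<in> set xs \<Longrightarrow> (algebraic over K) x"
  obtains M t where "subfield M R" "K \<subseteq> M" "w \<in> M" "set xs \<subseteq> M"
    "t \<in> ring_hom (R \<lparr> carrier := M \<rparr>) R" "\<And>k. k \<in> K \<Longrightarrow> t k = k" "t w = z"
proof -
  let ?E = "simple_extension K w"
  let ?M = "finite_extension ?E xs"
  have id: "(\<lambda>x. x) \<in> ring_hom (R \<lparr> carrier := K \<rparr>) R"
    using subfieldE(3)[OF K] by (auto intro!: ring_hom_memI)
  obtain s where s: "s \<in> ring_hom (R \<lparr> carrier := ?E \<rparr>) R" "\<And>k. k \<in> K \<Longrightarrow> s k = k" "s w = z"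
    using extend_hom[OF K id w, of z] z by auto
  have E: "subfield ?E R" using simple_extension_is_subfield[OF K w(1)] w(2) by simp
  have KE: "K \<subseteq> ?E" using simple_extension_incl[OF subfieldE(3)[OF K] w(1)] .
  have wE: "w \<in> ?E" using simple_extension_mem[OF subfieldE(1)[OF K] w(1)] .
  have alg: "(algebraic over ?E) x" if "x \<in> set xs" for x
    using algebraic_mono[OF KE, of x] xs(2)[OF that] by (simp add: over_def)
  obtain t where t: "t \<in> ring_hom (R \<lparr> carrier := ?M \<rparr>) R" "\<forall>m \<in> ?E. t m = s m"
    using extend_hom_finite[OF E s(1) xs(1) alg] by blast
  have M: "subfield ?M R" "?E \<subseteq> ?M" "set xs \<subseteq> ?M"
    using finite_extension_is_subfield[OF E xs(1) alg] finite_extension_incl[OF subfieldE(3)[OF E] xs(1)]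
      finite_extension_mem[OF subfieldE(1)[OF E] xs(1)] by blast+
  show thesis
  proof (rule that[OF M(1) _ _ M(3) t(1)])
    show "t k = k" if "k \<in> K" for k using s(2) t(2) KE that by auto
  qed (use M(2) KE wE s(3) t(2) in auto)
qed

lemma (in domain) hom_image_conjugate:
  assumes K: "subfield K R" and M: "subfield M R" "K \<subseteq> M"
    and t: "t \<in> ring_hom (R \<lparr> carrier := M \<rparr>) R" "\<And>k. k \<in> K \<Longrightarrow> t k = k"
    and c: "c \<in> M" "(algebraic over K) c"
  shows "t c \<in> carrier R" "eval (Irr K c) (t c) = \<zero>"
proof -
  have MR: "subring M R" using subfieldE(1)[OF M(1)] .
  interpret MM: ring "R \<lparr> carrier := M \<rparr>" using subring_is_ring[OF MR] .
  interpret h: ring_hom_ring "R \<lparr> carrier := M \<rparr>" R t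
    using ring_hom_ringI2[OF MM.ring_axioms ring_axioms t(1)] .
  have cR: "c \<in> carrier R" using c(1) subringE(1)[OF MR] by blast
  note f = IrrE[OF K cR c(2)]
  have fK: "set (Irr K c) \<subseteq> K" using f(1) unfolding univ_poly_def polynomial_def by auto
  show "t c \<in> carrier R" using h.hom_closed c(1) by simp
  have "map t (Irr K c) = Irr K c" using fK t(2) by (intro map_idI) auto
  then show "eval (Irr K c) (t c) = \<zero>"
    using h.eval_hom'[of c "Irr K c"] fK M(2) c(1) f(4) h.hom_zero by (auto simp: eval_consistent[OF MR])
qed

section \<open>Normality in terms of conjugates\<close>

text \<open>Splitting is tested on irreducible factors over \<open>E\<close>. A root in the ambient
  field has its minimal polynomial over \<open>E\<close> among them, so splitting makes it linear.
  Conversely, an irreducible factor of degree above 1 has a root in the ambient field, which would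
  lie in \<open>E\<close> and contradict irreducibility.\<close>

lemma (in alg_closed_field) splitted_subfield_iff:
  assumes E: "subfield E R" and p: "p \<in> carrier (E[X])" "p \<noteq> []"
  shows "ring.splitted (R \<lparr> carrier := E \<rparr>) p \<longleftrightarrow> (\<forall>y \<in> carrier R. eval p y = \<zero> \<longrightarrow> y \<in> E)"
proof -
  interpret EF: field "R \<lparr> carrier := E \<rparr>" using subfield_iff(2)[OF E] .
  have ER: "subring E R" using subfieldE(1)[OF E] .
  have EX: "univ_poly (R \<lparr> carrier := E \<rparr>) = univ_poly R" using univ_poly_consistent[OF ER] .
  have ev: "EF.eval = eval" using eval_consistent[OF ER] .
  have pE: "p \<in> carrier (poly_ring (R \<lparr> carrier := E \<rparr>))" using p(1) EX by simp
  have dvd: "q pdivides\<^bsub>R \<lparr> carrier := E \<rparr>\<^esub> p \<longleftrightarrow> q pdivides p" if "q \<in> carrier (E[X])" for q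
    using pdivides_iff_shell[OF E that p(1)] EX unfolding pdivides_def[of "R \<lparr> carrier := E \<rparr>"] by simp
  show ?thesis
  proof (intro iffI ballI impI)
    fix y assume split: "EF.splitted p" and y: "y \<in> carrier R" "eval p y = \<zero>"
    have alg: "(algebraic over E) y" using algebraicI[OF p y(2)] by (simp add: over_def)
    note g = IrrE[OF E y(1) alg]
    have "degree (Irr E y) = 1"
      using EF.splitted_imp_trivial_factors[OF pE p(2) split, of "Irr E y"] g(1,2) EX
        dvd[OF g(1)] Irr_minimal[OF E y(1) alg p(1) y(2)] by simp
    then show "y \<in> E" using Irr_degree_one_imp_mem[OF E y(1) alg] by simp
  next
    assume roots: "\<forall>y \<in> carrier R. eval p y = \<zero> \<longrightarrow> y \<in> E"
    show "EF.splitted p"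
    proof (rule EF.trivial_factors_imp_splitted[OF pE])
      fix q assume q: "q \<in> carrier (poly_ring (R \<lparr> carrier := E \<rparr>))"
        "pirreducible\<^bsub>R \<lparr> carrier := E \<rparr>\<^esub> (carrier (R \<lparr> carrier := E \<rparr>)) q" "q pdivides\<^bsub>R \<lparr> carrier := E \<rparr>\<^esub> p"
      have qE: "q \<in> carrier (E[X])" using q(1) EX by simp
      have qR: "q \<in> carrier (poly_ring R)" using carrier_polynomial_shell[OF ER qE] .
      show "degree q \<le> 1"
      proof (rule ccontr)
        assume deg: "\<not> degree q \<le> 1"
        then obtain y where y: "y \<in> carrier R" "eval q y = \<zero>" using exists_root[OF qR] by auto
        have "eval p y = \<zero>"
          using pdivides_imp_root_sharing[OF qR _ y] q(3) dvd[OF qE] by simp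
        then have "y \<in> E" using roots y(1) by blast
        moreover have "q \<noteq> []" using deg by auto
        ultimately have "EF.is_root q y" using y(2) ev unfolding EF.is_root_def by simp
        then show False
          using EF.pirreducible_roots[OF q(1,2)] deg EF.roots_mem_iff_is_root[OF q(1), of y] by simp
      qed
    qed
  qed
qed

text \<open>An irreducible polynomial with a root \<open>x\<close> in \<open>E\<close> is associated
  to \<open>Irr K x\<close>, so it has the same roots, namely the conjugates of
  \<open>x\<close>.\<close>

lemma (in alg_closed_field) normal_extension_iff:
  assumes K: "subfield K R" and E: "subfield E R" "K \<subseteq> E" and alg: "\<And>x. x \<in> E \<Longrightarrow> (algebraic over K) x"
  shows "normal_extension K E \<longleftrightarrow>
    (\<forall>x \<in> E. \<forall>y \<in> carrier R. eval (Irr K x) y = \<zero> \<longrightarrow> y \<in> E)" (is "_ \<longleftrightarrow> ?conj")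
proof -
  have KR: "subring K R" using subfieldE(1)[OF K] .
  have ER: "E \<subseteq> carrier R" using subfieldE(3)[OF E(1)] .
  have KE: "p \<in> carrier (E[X])" if "p \<in> carrier (K[X])" for p
    using that E(2) unfolding univ_poly_def polynomial_def by auto
  show ?thesis
  proof (intro iffI ballI impI)
    fix x y assume normal: "normal_extension K E" and x: "x \<in> E"
      and y: "y \<in> carrier R" "eval (Irr K x) y = \<zero>"
    have xR: "x \<in> carrier R" using x ER by blast
    note f = IrrE[OF K xR alg[OF x]]
    have "ring.splitted (R \<lparr> carrier := E \<rparr>) (Irr K x)"
      using normal f x unfolding normal_extension_def by blast
    then show "y \<in> E"
      using splitted_subfield_iff[OF E(1) KE[OF f(1)] pirreducibleE(1)[OF KR f(1,2)]] y by blast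
  next
    assume conj: ?conj
    have "ring.splitted (R \<lparr> carrier := E \<rparr>) p"
      if p: "p \<in> carrier (K[X])" "pirreducible K p" and x: "x \<in> E" "eval p x = \<zero>" for p x
    proof -
      have p0: "p \<noteq> []" using pirreducibleE(1)[OF KR p] .
      have xR: "x \<in> carrier R" using x ER by blast
      note f = IrrE[OF K xR alg[OF x(1)]]
      have "Irr K x divides\<^bsub>K[X]\<^esub> p"
        using Irr_minimal[OF K xR alg[OF x(1)] p(1) x(2)] pdivides_iff_shell[OF K f(1) p(1)] by blast
      moreover have "Irr K x \<notin> Units (K[X])" using pirreducibleE(2)[OF KR f(1,2)] .
      ultimately have "Irr K x \<sim>\<^bsub>K[X]\<^esub> p"
        using divides_pirreducible_condition[OF p(2) f(1)] by blast
      then obtain k where k: "k \<in> K - {\<zero>}" "Irr K x = [k] \<otimes>\<^bsub>K[X]\<^esub> p"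
        using associated_polynomials_iff[OF K f(1) p(1)] by blast
      have kX: "[k] \<in> carrier (K[X])" using k(1) unfolding univ_poly_def polynomial_def by auto
      have "y \<in> E" if y: "y \<in> carrier R" "eval p y = \<zero>" for y
      proof -
        have "k \<in> carrier R" using k(1) subringE(1)[OF KR] by auto
        then have "eval (Irr K x) y = \<zero>"
          unfolding k(2) using ring_hom_mult[OF eval_is_hom[OF KR y(1)] kX p(1)] y by simp
        then show ?thesis using conj x(1) y(1) by blast
      qed
      then show ?thesis using splitted_subfield_iff[OF E(1) KE[OF p(1)] p0] by blast
    qed
    then show "normal_extension K E" unfolding normal_extension_def using alg by blast
  qed
qed

section \<open>The maximal subextensions\<close>

lemma (in alg_closed_field) exists_separable_pow:
  assumes K: "subfield K R"
  shows "x \<in> carrier R \<Longrightarrow> (algebraic over K) x \<Longrightarrow> \<exists>e. separable_element K (x [^] (charexp ^ e))"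
proof (induction "degree (Irr K x)" arbitrary: x rule: less_induct)
  case less
  show ?case
  proof (cases "separable_element K x")
    case True
    then show ?thesis using less.prems(1) by (intro exI[of _ 0]) simp
  next
    case False
    have "\<exists>e. separable_element K ((x [^] charexp) [^] (charexp ^ e))"
      using inseparable_degree_pow_less[OF K less.prems False] less.prems
        algebraic_nat_pow(1)[OF K less.prems] by (intro less.hyps) auto
    then obtain e where "separable_element K ((x [^] charexp) [^] (charexp ^ e))" by blast
    then show ?thesis
      using less.prems(1) by (intro exI[of _ "Suc e"]) (simp add: nat_pow_pow)
  qed
qed

lemma (in alg_closed_field) exists_charexp_root:
  assumes "a \<in> carrier R"
  shows "\<exists>b \<in> carrier R. b [^] charexp = a"
proof -
  let ?m = "\<one> # replicate (charexp - 1) \<zero> @ [\<ominus> a]"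
  have "?m \<in> carrier (poly_ring R)"
    using pow_minus_const_closed[OF carrier_is_subring assms] by simp
  moreover have "degree ?m \<ge> 1" by (simp add: Suc_leI)
  ultimately obtain b where b: "b \<in> carrier R" and zero: "eval ?m b = \<zero>"
    using exists_root by blast
  have "eval ?m b = b [^] charexp \<ominus> a" using eval_pow_minus_const[OF assms b charexp_pos] .
  then have "b [^] charexp \<ominus> a = \<zero>" unfolding zero by (rule sym)
  then show ?thesis using assms b by auto
qed

lemma (in ring) subfield_inv_closed: "subfield E R \<Longrightarrow> x \<in> E \<Longrightarrow> x \<noteq> \<zero> \<Longrightarrow> inv x \<in> E"
  using subfield_m_inv(1)[of E x] by blast

lemma (in cring) inv_unique_left:
  assumes "x \<in> carrier R" "y \<in> carrier R" "y \<otimes> x = \<one>"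
  shows "y = inv x"
  using assms by (metis comm_inv_char m_comm)

locale finite_subextension = alg_closed_field R for R (structure) +
  fixes K L
  assumes K: "subfield K R" and L: "subfield L R" and KL: "K \<subseteq> L" and fin: "finite_dimension K L"
begin

text \<open>Elementwise descriptions of \<open>L\<^sub>S\<close>, \<open>L\<^sub>I\<close>, \<open>F'\<close> and \<open>F\<close>.\<close>

definition separables :: "'a set"
  where "separables = {x \<in> L. separable_element K x}"

definition p_radicals :: "'a set"
  where "p_radicals = {x \<in> L. \<exists>n::nat. x [^] (charexp ^ n) \<in> K}"

definition normal_core :: "'a set"
  where "normal_core = {x \<in> L. \<forall>y \<in> carrier R. eval (Irr K x) y = \<zero> \<longrightarrow> y \<in> L}"

definition galois_core :: "'a set"
  where "galois_core = separables \<inter> normal_core"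

lemma KR: "subring K R" and LR: "subring L R" and L_carrier: "L \<subseteq> carrier R"
  using subfieldE(1)[OF K] subfieldE(1)[OF L] subfieldE(3)[OF L] .

lemma algebraic_L: "x \<in> L \<Longrightarrow> (algebraic over K) x"
  using finite_dimension_imp_algebraic[OF K LR fin] .

lemma finite_dimension_intermediate:
  assumes "subfield E R" "K \<subseteq> E" "E \<subseteq> L"
  shows "finite_dimension K E"
  using subalbegra_incl_imp_finite_dimension[OF K fin subfield_is_subalgebra[OF assms(1,2)] assms(3)] .

lemma intermediate_eqI:
  assumes "subfield E R" "K \<subseteq> E" "E \<subseteq> L" "subfield E' R" "E' \<subseteq> L" "E \<subseteq> E'"
    and "(dim over K) E = (dim over K) E'"
  shows "E = E'"
proof -
  have fin': "finite_dimension K E" "finite_dimension K E'"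
    using finite_dimension_intermediate assms by auto
  obtain Us where Us: "set Us \<subseteq> carrier R" "independent K Us" "Span K Us = E" "length Us = (dim over K) E"
    using finite_dimension_base[OF K fin'(1)] by blast
  have "set Us \<subseteq> E'" using Span_base_incl[OF K Us(1)] Us(3) assms(6) by blast
  moreover have "length Us = (dim over K) E'" using Us(4) assms(7) by (rule trans)
  ultimately have "Span K Us = E'"
    using independent_length_eq_dimension[OF K finite_dimensionE[OF K fin'(2)] Us(2)] by blast
  then show ?thesis unfolding Us(3) .
qed

lemma dim_intermediate_le:
  assumes "subfield E R" "K \<subseteq> E" "E \<subseteq> L" "subfield E' R" "E' \<subseteq> L" "E \<subseteq> E'"
  shows "(dim over K) E \<le> (dim over K) E'"
proof -
  have fin': "finite_dimension K E" "finite_dimension K E'"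
    using finite_dimension_intermediate assms by auto
  obtain Us where Us: "set Us \<subseteq> carrier R" "independent K Us" "Span K Us = E" "length Us = (dim over K) E"
    using finite_dimension_base[OF K fin'(1)] by blast
  have "set Us \<subseteq> E'" using Span_base_incl[OF K Us(1)] Us(3) assms(6) by blast
  then show ?thesis
    using independent_length_le_dimension[OF K finite_dimensionE[OF K fin'(2)] Us(2)] Us(4) by simp
qed

section \<open>The candidate sets are fields\<close>

lemma K_subset_separables: "K \<subseteq> separables"
proof
  fix k assume k: "k \<in> K"
  then have kR: "k \<in> carrier R" using KR subringE(1) by blast
  have "k \<in> simple_extension K (k [^] charexp)"
    using simple_extension_incl[OF subfieldE(3)[OF K]] kR k by blast
  then show "k \<in> separables"
    using separable_iff_mem_simple_extension[OF K kR] algebraic_self[OF KR k] k KL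
    unfolding separables_def by auto
qed

text \<open>K(a, b) is generated by separable elements and hence separable throughout. Sums,
  products and inverses are formed inside it.\<close>

lemma separable_pair:
  assumes "a \<in> separables" "b \<in> separables"
  obtains E where "subfield E R" "a \<in> E" "b \<in> E" "\<And>z. z \<in> E \<Longrightarrow> separable_element K z"
proof -
  let ?E = "finite_extension K [a, b]"
  have ab: "set [a, b] \<subseteq> carrier R" "\<And>x. x \<in> set [a, b] \<Longrightarrow> (algebraic over K) x"
    "\<And>x. x \<in> {a, b} \<Longrightarrow> separable_element K x"
    using assms L_carrier algebraic_L unfolding separables_def by auto
  have E: "subfield ?E R" "K \<subseteq> ?E" "finite_dimension K ?E" "set [a, b] \<subseteq> ?E"
    using finite_extension_is_subfield[OF K ab(1,2)] finite_extension_incl[OF subfieldE(3)[OF K] ab(1)]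
      finite_extension_finite_dimension(1)[OF K ab(1,2)] finite_extension_mem[OF KR ab(1)] by blast+
  have S: "{a, b} \<subseteq> ?E" using E(4) by simp
  have gen: "?E \<subseteq> V" if "subring V R" "K \<subseteq> V" "{a, b} \<subseteq> V" for V
    using finite_extension_subring_incl[OF that(1,2), of "[a, b]"] that(3) by simp
  have sep: "separable_element K z" if "z \<in> ?E" for z
    using separable_generated[OF K E(1,2,3) S ab(3) gen that] .
  from S have "a \<in> ?E" "b \<in> ?E" by blast+
  from that[OF E(1) this sep] show thesis .
qed

lemma subfield_separables: "subfield separables R"
proof (rule subfieldI'[OF subringI])
  show "separables \<subseteq> carrier R" unfolding separables_def using L_carrier by blast
  show "\<one> \<in> separables" using K_subset_separables subringE(3)[OF KR] by blast
next
  fix a b assume ab: "a \<in> separables" "b \<in> separables"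
  then obtain E where E: "subfield E R" "a \<in> E" "b \<in> E" "\<And>z. z \<in> E \<Longrightarrow> separable_element K z"
    using separable_pair by blast
  note ER = subfieldE(1)[OF E(1)]
  have abL: "a \<in> L" "b \<in> L" using ab unfolding separables_def by auto
  show "a \<otimes> b \<in> separables" "a \<oplus> b \<in> separables"
    using E(4) subringE(6,7)[OF ER E(2,3)] subringE(6,7)[OF LR abL] unfolding separables_def by auto
next
  fix a assume a: "a \<in> separables"
  then obtain E where E: "subfield E R" "a \<in> E" "\<And>z. z \<in> E \<Longrightarrow> separable_element K z"
    using separable_pair by blast
  show "\<ominus> a \<in> separables"
    using E(3) subringE(5)[OF subfieldE(1)[OF E(1)] E(2)] subringE(5)[OF LR] a unfolding separables_def by auto
next
  fix a assume a: "a \<in> separables - {\<zero>}"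
  then obtain E where E: "subfield E R" "a \<in> E" "\<And>z. z \<in> E \<Longrightarrow> separable_element K z"
    using separable_pair by blast
  show "inv a \<in> separables"
    using E(3) subfield_inv_closed[OF E(1,2)] subfield_inv_closed[OF L] a unfolding separables_def by auto
qed

lemma K_subset_p_radicals: "K \<subseteq> p_radicals"
proof
  fix k assume "k \<in> K"
  then have "k [^] (charexp ^ 0) \<in> K" "k \<in> L" using subring_pow_closed[OF KR] KL by blast+
  then show "k \<in> p_radicals" unfolding p_radicals_def by blast
qed

lemma p_radicals_common_exponent:
  assumes "a \<in> p_radicals" "b \<in> p_radicals"
  obtains n where "a [^] (charexp ^ n) \<in> K" "b [^] (charexp ^ n) \<in> K"
proof -
  obtain i j where ij: "a [^] (charexp ^ i) \<in> K" "b [^] (charexp ^ j) \<in> K"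
    using assms unfolding p_radicals_def by blast
  have ab: "a \<in> carrier R" "b \<in> carrier R" using assms L_carrier unfolding p_radicals_def by auto
  have "a [^] (charexp ^ (i + j)) = (a [^] (charexp ^ i)) [^] (charexp ^ j)"
    "b [^] (charexp ^ (i + j)) = (b [^] (charexp ^ j)) [^] (charexp ^ i)"
    using ab by (simp_all add: nat_pow_pow power_add mult.commute)
  then show thesis
    using that[of "i + j"] subring_pow_closed[OF subfieldE(1)[OF K] ij(1), of "charexp ^ j"]
      subring_pow_closed[OF subfieldE(1)[OF K] ij(2), of "charexp ^ i"] by simp
qed

lemma subfield_p_radicals: "subfield p_radicals R"
proof (rule subfieldI'[OF subringI])
  show "p_radicals \<subseteq> carrier R" unfolding p_radicals_def using L_carrier by blast
  show "\<one> \<in> p_radicals" using K_subset_p_radicals subringE(3)[OF KR] by blast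
next
  fix a b assume ab: "a \<in> p_radicals" "b \<in> p_radicals"
  then obtain n where n: "a [^] (charexp ^ n) \<in> K" "b [^] (charexp ^ n) \<in> K"
    using p_radicals_common_exponent by blast
  interpret frob: ring_hom_ring R R "\<lambda>x. x [^] (charexp ^ n)" by (rule frobenius_hom)
  have abL: "a \<in> L" "b \<in> L" and abR: "a \<in> carrier R" "b \<in> carrier R"
    using ab L_carrier unfolding p_radicals_def by auto
  have "(a \<otimes> b) [^] (charexp ^ n) \<in> K" "(a \<oplus> b) [^] (charexp ^ n) \<in> K"
    using frob.hom_mult[OF abR] frob.hom_add[OF abR] subringE(6,7)[OF KR n] by simp_all
  then show "a \<otimes> b \<in> p_radicals" "a \<oplus> b \<in> p_radicals"
    using subringE(6,7)[OF LR abL] unfolding p_radicals_def by blast+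
next
  fix a assume a: "a \<in> p_radicals"
  then obtain n where n: "a [^] (charexp ^ n) \<in> K" unfolding p_radicals_def by blast
  interpret frob: ring_hom_ring R R "\<lambda>x. x [^] (charexp ^ n)" by (rule frobenius_hom)
  have aR: "a \<in> carrier R" "a \<in> L" using a L_carrier unfolding p_radicals_def by auto
  have "(\<ominus> a) [^] (charexp ^ n) = \<ominus> (a [^] (charexp ^ n))" using frob.hom_a_inv[OF aR(1)] .
  then have "(\<ominus> a) [^] (charexp ^ n) \<in> K" using subringE(5)[OF KR n] by simp
  then show "\<ominus> a \<in> p_radicals"
    using subringE(5)[OF LR aR(2)] unfolding p_radicals_def by blast
next
  fix a assume a: "a \<in> p_radicals - {\<zero>}"
  then obtain n where n: "a [^] (charexp ^ n) \<in> K" unfolding p_radicals_def by blast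
  have aR: "a \<in> carrier R" "a \<in> L" "a \<noteq> \<zero>" using a L_carrier unfolding p_radicals_def by auto
  have inv: "inv a \<in> carrier R" "inv a \<otimes> a = \<one>" using aR field_Units by auto
  have "inv a [^] (charexp ^ n) \<otimes> a [^] (charexp ^ n) = \<one>"
    using nat_pow_distrib[OF inv(1) aR(1), of "charexp ^ n"] inv(2) by simp
  then have "inv a [^] (charexp ^ n) = inv (a [^] (charexp ^ n))"
    using aR inv by (intro inv_unique_left) auto
  moreover have "a [^] (charexp ^ n) \<noteq> \<zero>" using nat_pow_zero_imp_zero aR by blast
  ultimately have "inv a [^] (charexp ^ n) \<in> K" using subfield_inv_closed[OF K n] by simp
  then show "inv a \<in> p_radicals"
    using subfield_inv_closed[OF L aR(2,3)] unfolding p_radicals_def by blast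
qed

text \<open>A conjugate of an element of \<open>K(a, b)\<close> is its image under a \<open>K\<close>-homomorphism, which maps
  \<open>a\<close> and \<open>b\<close> to conjugates of themselves.\<close>

lemma normal_core_pair_hom:
  assumes ab: "a \<in> normal_core" "b \<in> normal_core"
    and w: "w \<in> L" and z: "z \<in> carrier R" "eval (Irr K w) z = \<zero>"
  obtains M t where "subfield M R" "a \<in> M" "b \<in> M" "w \<in> M" "ring_hom_ring (R \<lparr> carrier := M \<rparr>) R t"
    "t w = z" "t a \<in> L" "t b \<in> L"
proof -
  have abL: "set [a, b] \<subseteq> L" and abR: "set [a, b] \<subseteq> carrier R"
    using ab L_carrier unfolding normal_core_def by auto
  have wR: "w \<in> carrier R" using w L_carrier by blast
  have alg: "\<And>x. x \<in> set [a, b] \<Longrightarrow> (algebraic over K) x" using abL algebraic_L by blast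
  obtain M t where M: "subfield M R" "K \<subseteq> M" "w \<in> M" "set [a, b] \<subseteq> M"
    and t: "t \<in> ring_hom (R \<lparr> carrier := M \<rparr>) R" "\<And>k. k \<in> K \<Longrightarrow> t k = k" "t w = z"
    using conjugate_hom[OF K wR algebraic_L[OF w] z abR alg] by blast
  have img: "t c \<in> L" if "c \<in> {a, b}" for c
    using hom_image_conjugate[OF K M(1,2) t(1,2), of c] that ab M(4) alg[of c]
    unfolding normal_core_def by auto
  have "ring_hom_ring (R \<lparr> carrier := M \<rparr>) R t"
    using ring_hom_ringI2[OF subring_is_ring[OF subfieldE(1)[OF M(1)]] ring_axioms t(1)] .
  from that[OF M(1) _ _ M(3) this t(3)] img M(4) show thesis by auto
qed

lemma K_subset_normal_core: "K \<subseteq> normal_core"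
proof
  fix k assume k: "k \<in> K"
  have kR: "k \<in> carrier R" using k KR subringE(1) by blast
  have "y \<in> L" if "y \<in> carrier R" "eval (Irr K k) y = \<zero>" for y
    \<comment> \<open>Exponent 1 amounts to the polynomial X - k: an element of \<open>K\<close> is
      its own only conjugate.\<close>
    using conjugate_pow_eq[OF K kR algebraic_self[OF KR k], of 1 y] that k kR KL by auto
  then show "k \<in> normal_core" unfolding normal_core_def using k KL by blast
qed

lemma subfield_normal_core: "subfield normal_core R"
proof (rule subfieldI'[OF subringI])
  show "normal_core \<subseteq> carrier R" unfolding normal_core_def using L_carrier by blast
  show "\<one> \<in> normal_core" using K_subset_normal_core subringE(3)[OF KR] by blast
next
  fix a b assume ab: "a \<in> normal_core" "b \<in> normal_core"
  have abL: "a \<in> L" "b \<in> L" using ab unfolding normal_core_def by auto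
  have mult: "a \<otimes> b \<in> L" and add: "a \<oplus> b \<in> L" using subringE(6,7)[OF LR abL] .
  have "z \<in> L" if "z \<in> carrier R" "eval (Irr K (a \<otimes> b)) z = \<zero>" for z
  proof (rule normal_core_pair_hom[OF ab mult that])
    fix M t assume M: "a \<in> M" "b \<in> M" "ring_hom_ring (R \<lparr> carrier := M \<rparr>) R t"
      "t (a \<otimes> b) = z" "t a \<in> L" "t b \<in> L"
    interpret t: ring_hom_ring "R \<lparr> carrier := M \<rparr>" R t by fact
    show "z \<in> L" using t.hom_mult[of a b] M subringE(6)[OF LR M(5,6)] by simp
  qed
  then show "a \<otimes> b \<in> normal_core" unfolding normal_core_def using mult by blast
  have "z \<in> L" if "z \<in> carrier R" "eval (Irr K (a \<oplus> b)) z = \<zero>" for z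
  proof (rule normal_core_pair_hom[OF ab add that])
    fix M t assume M: "a \<in> M" "b \<in> M" "ring_hom_ring (R \<lparr> carrier := M \<rparr>) R t"
      "t (a \<oplus> b) = z" "t a \<in> L" "t b \<in> L"
    interpret t: ring_hom_ring "R \<lparr> carrier := M \<rparr>" R t by fact
    show "z \<in> L" using t.hom_add[of a b] M subringE(7)[OF LR M(5,6)] by simp
  qed
  then show "a \<oplus> b \<in> normal_core" unfolding normal_core_def using add by blast
next
  fix a assume a: "a \<in> normal_core"
  have aL: "a \<in> L" "a \<in> carrier R" using a L_carrier unfolding normal_core_def by auto
  have minus: "\<ominus> a \<in> L" using subringE(5)[OF LR aL(1)] .
  have "z \<in> L" if "z \<in> carrier R" "eval (Irr K (\<ominus> a)) z = \<zero>" for z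
  proof (rule normal_core_pair_hom[OF a a minus that])
    fix M t assume M: "a \<in> M" "\<ominus> a \<in> M" "ring_hom_ring (R \<lparr> carrier := M \<rparr>) R t"
      "t (\<ominus> a) = z" "t a \<in> L"
    interpret t: ring_hom_ring "R \<lparr> carrier := M \<rparr>" R t by fact
    have "t a \<oplus> z = \<zero>"
      using t.hom_add[of a "\<ominus> a"] t.hom_zero M(1,2,4) aL(2) by (simp add: r_neg)
    then have "z = \<ominus> t a"
      using that(1) M(5) L_carrier by (metis minus_equality minus_minus a_inv_closed a_comm subsetD)
    then show "z \<in> L" using subringE(5)[OF LR M(5)] by simp
  qed
  then show "\<ominus> a \<in> normal_core" unfolding normal_core_def using minus by blast
next
  fix a assume a0: "a \<in> normal_core - {\<zero>}"
  then have a: "a \<in> normal_core" by simp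
  have aL: "a \<in> L" "a \<in> carrier R" "a \<noteq> \<zero>" using a0 L_carrier unfolding normal_core_def by auto
  have inv: "inv a \<in> L" using subfield_inv_closed[OF L aL(1,3)] .
  have "z \<in> L" if "z \<in> carrier R" "eval (Irr K (inv a)) z = \<zero>" for z
  proof (rule normal_core_pair_hom[OF a a inv that])
    fix M t assume M: "a \<in> M" "inv a \<in> M" "ring_hom_ring (R \<lparr> carrier := M \<rparr>) R t"
      "t (inv a) = z" "t a \<in> L"
    interpret t: ring_hom_ring "R \<lparr> carrier := M \<rparr>" R t by fact
    have "z \<otimes> t a = \<one>"
      using t.hom_mult[of "inv a" a] t.hom_one M(1,2,4) aL field_Units by simp
    then have "z = inv (t a)" "t a \<noteq> \<zero>"
      using that(1) M(5) L_carrier inv_unique_left[of "t a" z] by auto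
    then show "z \<in> L" using subfield_inv_closed[OF L M(5)] by simp
  qed
  then show "inv a \<in> normal_core" unfolding normal_core_def using inv by blast
qed

text \<open>A conjugate has the same minimal polynomial and so the same conjugates. This is what
  makes the core normal over \<open>K\<close> and not just a set of elements with conjugates in
  \<open>L\<close>.\<close>

lemma normal_core_conjugate_closed:
  assumes "x \<in> normal_core" "y \<in> carrier R" "eval (Irr K x) y = \<zero>"
  shows "y \<in> normal_core"
  using assms Irr_conjugate(2)[OF K _ algebraic_L assms(2,3)] L_carrier
  unfolding normal_core_def by auto

lemma subfield_galois_core: "subfield galois_core R" "K \<subseteq> galois_core" "galois_core \<subseteq> L"
proof -
  show "subfield galois_core R"
    unfolding galois_core_def
  proof (rule subfieldI'[OF subring_inter])
    show "inv k \<in> separables \<inter> normal_core" if "k \<in> separables \<inter> normal_core - {\<zero>}" for k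
      using that subfield_inv_closed[OF subfield_separables] subfield_inv_closed[OF subfield_normal_core]
      by auto
  qed (use subfieldE(1)[OF subfield_separables] subfieldE(1)[OF subfield_normal_core] in auto)
  show "K \<subseteq> galois_core" "galois_core \<subseteq> L"
    using K_subset_separables K_subset_normal_core unfolding galois_core_def separables_def by auto
qed

section \<open>Identification of the maximal subextensions\<close>

lemma normal_extension_intermediate_iff:
  assumes "subextension K L E"
  shows "normal_extension K E \<longleftrightarrow>
    (\<forall>x \<in> E. \<forall>y \<in> carrier R. eval (Irr K x) y = \<zero> \<longrightarrow> y \<in> E)"
  using assms algebraic_L unfolding subextension_def by (intro normal_extension_iff[OF K]) auto

lemma normal_imp_subset_normal_core:
  assumes "subextension K L E" "normal_extension K E"
  shows "E \<subseteq> normal_core"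
  using assms normal_extension_intermediate_iff[OF assms(1)]
  unfolding normal_core_def subextension_def by blast

lemma maximal_separable_eq: "maximal_separable K L = separables"
  unfolding maximal_separable_def
proof (rule Greatest_equality)
  show "subextension K L separables \<and> separable_extension K separables"
    using subfield_separables K_subset_separables
    unfolding subextension_def separable_extension_def separables_def by auto
qed (auto simp: subextension_def separable_extension_def separables_def)

lemma maximal_purely_inseparable_eq: "maximal_purely_inseparable K L = p_radicals"
  unfolding maximal_purely_inseparable_def
proof (rule Greatest_equality)
  show "subextension K L p_radicals \<and> purely_inseparable_extension K p_radicals"
    using subfield_p_radicals K_subset_p_radicals
    unfolding subextension_def purely_inseparable_extension_def p_radicals_def by auto
qed (auto simp: subextension_def purely_inseparable_extension_def p_radicals_def)

lemma normal_extension_normal_core: "subextension K L normal_core" "normal_extension K normal_core"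
proof -
  show sub: "subextension K L normal_core"
    using subfield_normal_core K_subset_normal_core unfolding subextension_def normal_core_def by auto
  show "normal_extension K normal_core"
    unfolding normal_extension_intermediate_iff[OF sub] using normal_core_conjugate_closed by blast
qed

text \<open>Separability depends only on the minimal polynomial, which conjugates share, so passing
  to separable elements keeps the core closed under conjugation.\<close>

lemma galois_core_normal: "subextension K L galois_core" "normal_extension K galois_core"
proof -
  show sub: "subextension K L galois_core"
    using subfield_galois_core unfolding subextension_def by auto
  have "y \<in> galois_core" if "x \<in> galois_core" "y \<in> carrier R" "eval (Irr K x) y = \<zero>" for x y
  proof -
    have x: "x \<in> L" "x \<in> carrier R" "separable_element K x" "x \<in> normal_core"
      using that(1) L_carrier unfolding galois_core_def separables_def by auto
    have "y \<in> normal_core" using normal_core_conjugate_closed[OF x(4) that(2,3)] .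
    moreover from this have "y \<in> L" unfolding normal_core_def by simp
    moreover have "separable_element K y"
      using x(3) Irr_conjugate[OF K x(2) algebraic_L[OF x(1)] that(2,3)]
      unfolding separable_element_def by simp
    ultimately show ?thesis unfolding galois_core_def separables_def by simp
  qed
  then show "normal_extension K galois_core"
    unfolding normal_extension_intermediate_iff[OF sub] by blast
qed

lemma maximal_galois_eq: "maximal_galois K L = galois_core"
  unfolding maximal_galois_def
proof (rule Greatest_equality)
  show "subextension K L galois_core \<and> galois_extension K galois_core"
    using galois_core_normal unfolding galois_extension_def separable_extension_def galois_core_def separables_def
    by auto
  fix E assume "subextension K L E \<and> galois_extension K E"
  then show "E \<subseteq> galois_core"
    using normal_imp_subset_normal_core
    unfolding galois_extension_def separable_extension_def galois_core_def separables_def subextension_def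
    by auto
qed

text \<open>The core contains every normal subextension, so its degree is maximal. A normal
  subextension of the same degree equals it by dimension, which is the uniqueness that
  \<open>THE\<close> requires.\<close>

lemma maximal_normal_eq: "maximal_normal K L = normal_core"
  unfolding maximal_normal_def
proof (rule the_equality)
  note core = normal_extension_normal_core
  have le: "(dim over K) E \<le> (dim over K) normal_core" if "subextension K L E" "normal_extension K E" for E
    using that core(1) normal_imp_subset_normal_core[OF that] unfolding subextension_def
    by (intro dim_intermediate_le) auto
  then show "is_arg_max (dim over K) (\<lambda>E. subextension K L E \<and> normal_extension K E) normal_core"
    using core unfolding is_arg_max_def by (auto simp: not_less)
  fix E assume E: "is_arg_max (dim over K) (\<lambda>E. subextension K L E \<and> normal_extension K E) E"
  then have sub: "subextension K L E" "normal_extension K E"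
    and max: "(dim over K) normal_core \<le> (dim over K) E"
    using core unfolding is_arg_max_def by (auto simp: not_less)
  show "E = normal_core"
    using sub(1) core(1) normal_imp_subset_normal_core[OF sub] le[OF sub] max unfolding subextension_def
    by (intro intermediate_eqI) auto
qed

section \<open>Decomposition of the normal core\<close>

text \<open>A conjugate of \<open>x\<close> has the same q-th power for some power q of
  \<open>charexp\<close>, hence equals \<open>x\<close>.\<close>

lemma p_radicals_subset_normal_core: "p_radicals \<subseteq> normal_core"
proof
  fix x assume x: "x \<in> p_radicals"
  then obtain n where n: "x [^] (charexp ^ n) \<in> K" unfolding p_radicals_def by blast
  have xL: "x \<in> L" "x \<in> carrier R" using x L_carrier unfolding p_radicals_def by auto
  have "y = x" if y: "y \<in> carrier R" "eval (Irr K x) y = \<zero>" for y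
    using conjugate_pow_eq[OF K xL(2) algebraic_L[OF xL(1)] _ n y] frobenius_inj[OF y(1) xL(2)] by simp
  then show "x \<in> normal_core" using xL unfolding normal_core_def by auto
qed

text \<open>If the minimal polynomial over \<open>L\<^sub>I\<close> were a polynomial in \<open>X\<^sup>p\<close>, it would be the \<open>p\<close>-th power
  of a polynomial with roots in \<open>L\<close>, whose coefficients lie in \<open>L\<close> and hence in \<open>L\<^sub>I\<close>.\<close>

lemma normal_core_separable_over_p_radicals:
  assumes x: "x \<in> normal_core"
  shows "separable_element p_radicals x"
proof (rule ccontr)
  assume insep: "\<not> separable_element p_radicals x"
  note I = subfield_p_radicals
  have IR: "subring p_radicals R" using subfieldE(1)[OF I] .
  have xL: "x \<in> L" "x \<in> carrier R" using x L_carrier unfolding normal_core_def by auto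
  have alg: "(algebraic over p_radicals) x"
    using algebraic_mono[OF K_subset_p_radicals, of x] algebraic_L[OF xL(1)] by (simp add: over_def)
  obtain h where h: "charexp > 1" "h \<in> carrier (p_radicals[X])" "h \<noteq> []" "lead_coeff h = \<one>"
    "degree (Irr p_radicals x) = charexp * degree h" "degree h \<ge> 1"
    "\<And>z. z \<in> carrier R \<Longrightarrow> eval (Irr p_radicals x) z = eval h (z [^] charexp)"
    using inseparable_Irr[OF I xL(2) alg insep] by metis
  define r where "r = (\<lambda>a. SOME b. b \<in> carrier R \<and> b [^] charexp = a)"
  have r: "r a \<in> carrier R" "r a [^] charexp = a" if "a \<in> carrier R" for a
    using someI_ex[of "\<lambda>b. b \<in> carrier R \<and> b [^] charexp = a"] exists_charexp_root[OF that]
    unfolding r_def by auto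
  have hI: "set h \<subseteq> p_radicals" "set h \<subseteq> carrier R"
    using h(2) subringE(1)[OF IR] unfolding univ_poly_def polynomial_def by auto
  \<comment> \<open>Coefficientwise p-th roots: Frobenius gives g(z)^p = h(z^p), so g is a p-th root
    of the minimal polynomial of \<open>x\<close> over \<open>p_radicals\<close>.\<close>
  let ?g = "map r h"
  have gR: "set ?g \<subseteq> carrier R" using hI(2) r(1) by auto
  interpret frob: ring_hom_ring R R "\<lambda>x. x [^] charexp" using frobenius_hom[of 1] by simp
  have "map (\<lambda>x. x [^] charexp) ?g = h" using hI(2) r(2) by (auto intro!: map_idI)
  then have g_eval: "eval ?g z [^] charexp = eval (Irr p_radicals x) z" if "z \<in> carrier R" for z
    using frob.eval_hom'[OF that gR] h(7)[OF that] by simp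
  have g_root: "eval (Irr p_radicals x) z = \<zero> \<longleftrightarrow> eval ?g z = \<zero>" if "z \<in> carrier R" for z
    using g_eval[OF that] nat_pow_zero_imp_zero[of "eval ?g z" charexp] eval_in_carrier[OF gR that]
      frob.hom_zero by metis
  have "lead_coeff ?g [^] charexp = \<one>" using r(2)[of \<one>] h(3,4) by (simp add: hd_map)
  then have lead: "lead_coeff ?g = \<one>"
    using frobenius_inj[of "lead_coeff ?g" \<one> 1] r(1)[of \<one>] h(3,4) by (simp add: hd_map)
  have g0: "?g \<noteq> []" using h(3) by simp
  have gX: "?g \<in> carrier (poly_ring R)"
    using gR lead unfolding univ_poly_def polynomial_def by auto
  have "?g \<in> carrier (L[X])"
  proof (rule monic_roots_in_subring[OF LR gX g0 lead])
    fix y assume y: "y \<in> carrier R" "eval ?g y = \<zero>"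
    \<comment> \<open>Conjugates over the larger field \<open>p_radicals\<close> are conjugates over
      \<open>K\<close>, which lie in \<open>L\<close> since \<open>x\<close> is in the core.\<close>
    have "Irr K x \<in> carrier (p_radicals[X])"
      using IrrE(1)[OF K xL(2) algebraic_L[OF xL(1)]] K_subset_p_radicals
      unfolding univ_poly_def polynomial_def by auto
    then have "eval (Irr K x) y = \<zero>"
      using eval_conjugate_eq_zero[OF I xL(2) alg _ _ y(1)] IrrE(4)[OF K xL(2) algebraic_L[OF xL(1)]]
        g_root[OF y(1)] y(2) by blast
    then show "y \<in> L" using x y(1) unfolding normal_core_def by blast
  qed
  then have gL: "set ?g \<subseteq> L" unfolding univ_poly_def polynomial_def by auto
  have "b \<in> p_radicals" if b: "b \<in> set ?g" for b
  proof -
    obtain a where a: "a \<in> set h" "b = r a" using b by auto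
    then have "a \<in> carrier R" "a \<in> p_radicals" using hI by auto
    then have "b [^] charexp \<in> p_radicals" "b \<in> carrier R" unfolding a(2) using r by simp_all
    then obtain n where n: "(b [^] charexp) [^] (charexp ^ n) \<in> K" "b \<in> carrier R"
      unfolding p_radicals_def by blast
    then have "b [^] (charexp ^ Suc n) \<in> K" by (simp add: nat_pow_pow)
    then show ?thesis using gL b unfolding p_radicals_def by blast
  qed
  then have "?g \<in> carrier (p_radicals[X])"
    using lead unfolding univ_poly_def polynomial_def by auto
  \<comment> \<open>\<open>?g\<close> vanishes at \<open>x\<close>, yet its degree is that of the
    minimal polynomial divided by p > 1.\<close>
  then have "degree (Irr p_radicals x) \<le> degree ?g"
    using Irr_degree_le[OF I xL(2) alg _ g0] g_root[OF xL(2)] IrrE(4)[OF I xL(2) alg] by blast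
  then show False using h(1,5,6) by simp
qed

lemma normal_core_eq_compositum: "normal_core = compositum galois_core p_radicals"
proof
  note c = compositum_subfields[OF subfield_galois_core(1) subfield_p_radicals]
  show "compositum galois_core p_radicals \<subseteq> normal_core"
    using c(4)[OF subfield_normal_core] p_radicals_subset_normal_core unfolding galois_core_def by blast
  show "normal_core \<subseteq> compositum galois_core p_radicals"
  proof
    fix x assume x: "x \<in> normal_core"
    note I = subfield_p_radicals
    have xL: "x \<in> L" "x \<in> carrier R" using x L_carrier unfolding normal_core_def by auto
    have pow: "x [^] n \<in> normal_core" for n :: nat
      using subring_pow_closed[OF subfieldE(1)[OF subfield_normal_core] x] .
    have powR: "x [^] n \<in> carrier R" for n :: nat using xL(2) by simp
    have alg: "(algebraic over p_radicals) (x [^] n)" for n :: nat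
      using algebraic_mono[OF K_subset_p_radicals, of "x [^] n"] algebraic_L subring_pow_closed[OF subfieldE(1)[OF L] xL(1)]
      by (simp add: over_def)
    \<comment> \<open>All powers of \<open>x\<close> stay in the core, so each is separable over
      \<open>p_radicals\<close>; the criterion shows that replacing x^q by its p-th power does not
      shrink the generated field.\<close>
    have mem: "x \<in> simple_extension p_radicals (x [^] (charexp ^ e))" for e
    proof (induction e)
      case 0
      show ?case using simple_extension_mem[OF subfieldE(1)[OF I] xL(2)] xL(2) by simp
    next
      case (Suc e)
      let ?y = "x [^] (charexp ^ e)"
      have eq: "?y [^] charexp = x [^] (charexp ^ Suc e)"
        using xL(2) by (simp add: nat_pow_pow mult.commute)
      have "?y \<in> simple_extension p_radicals (x [^] (charexp ^ Suc e))"
        using separable_iff_mem_simple_extension[OF I powR alg]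
          normal_core_separable_over_p_radicals[OF pow] unfolding eq[symmetric] by blast
      then have "simple_extension p_radicals ?y \<subseteq> simple_extension p_radicals (x [^] (charexp ^ Suc e))"
        using simple_extension_subring_incl[OF simple_extension_is_subring[OF subfieldE(1)[OF I] powR]]
          simple_extension_incl[OF subfieldE(3)[OF I] powR] by blast
      then show ?case using Suc by blast
    qed
    obtain e where "separable_element K (x [^] (charexp ^ e))"
      using exists_separable_pow[OF K xL(2) algebraic_L[OF xL(1)]] by blast
    then have "x [^] (charexp ^ e) \<in> galois_core"
      using pow[of "charexp ^ e"] unfolding galois_core_def separables_def normal_core_def by auto
    then have "simple_extension p_radicals (x [^] (charexp ^ e)) \<subseteq> compositum galois_core p_radicals"
      using simple_extension_subring_incl[OF subfieldE(1)[OF c(1)] c(3)] c(2) by blast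
    then show "x \<in> compositum galois_core p_radicals" using mem by blast
  qed
qed

section \<open>Degree formulas\<close>

lemma finite_dimension_cores:
  "finite_dimension K separables" "finite_dimension K p_radicals" "finite_dimension K galois_core"
  using subfield_separables subfield_p_radicals subfield_galois_core K_subset_separables K_subset_p_radicals
  by (auto intro!: finite_dimension_intermediate simp: separables_def p_radicals_def)

lemma p_radicals_purely_inseparable: "purely_inseparable_extension K p_radicals"
  unfolding purely_inseparable_extension_def p_radicals_def by blast

lemma dim_normal_core:
  "(dim over K) normal_core = (dim over K) galois_core * (dim over K) p_radicals"
  unfolding normal_core_eq_compositum
proof (rule dim_compositum[OF K subfield_galois_core(1) finite_dimension_cores(3) _
      subfield_p_radicals K_subset_p_radicals finite_dimension_cores(2) p_radicals_purely_inseparable])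
  show "separable_extension K galois_core"
    unfolding separable_extension_def galois_core_def separables_def by auto
qed

lemma dim_separable_compositum:
  "(dim over K) (compositum separables p_radicals)
    = (dim over K) separables * (dim over K) p_radicals"
proof (rule dim_compositum[OF K subfield_separables finite_dimension_cores(1) _
      subfield_p_radicals K_subset_p_radicals finite_dimension_cores(2) p_radicals_purely_inseparable])
  show "separable_extension K separables"
    unfolding separable_extension_def separables_def by auto
qed

text \<open>The tower law through F, that is [L_S : K] = t u. Finiteness over F holds because a
  \<open>K\<close>-basis of L_S also spans it over F.\<close>

lemma dim_separables:
  "(dim over K) separables = (dim over K) galois_core * (dim over galois_core) separables"
proof -
  note F = subfield_galois_core
  obtain Us where Us: "set Us \<subseteq> carrier R" "independent K Us" "Span K Us = separables"
      "length Us = (dim over K) separables"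
    using finite_dimension_base[OF K finite_dimension_cores(1)] by blast
  have "set Us \<subseteq> separables" using Span_base_incl[OF K Us(1)] Us(3) by simp
  have "subalgebra galois_core separables R"
    using subfield_is_subalgebra[OF subfield_separables] unfolding galois_core_def by blast
  then have "Span galois_core Us \<subseteq> separables"
    using subalgebra_Span_incl[OF F(1)] \<open>set Us \<subseteq> separables\<close> by blast
  moreover have "separables \<subseteq> Span galois_core Us"
    using Span_mono_subfield[OF K F(1,2) Us(1)] Us(3) by simp
  ultimately have "finite_dimension galois_core separables"
    using Span_finite_dimension[OF F(1) Us(1)] by (metis subset_antisym)
  then show ?thesis
    using telescopic_base_dim(2)[OF K F(1) finite_dimension_cores(3)] by blast
qed

lemma normal_extension_iff_dim:
  "normal_extension K L \<longleftrightarrow> (dim over K) normal_core = (dim over K) L"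
proof
  have sub: "subextension K L L" using L KL unfolding subextension_def by simp
  have le: "normal_core \<subseteq> L" unfolding normal_core_def by blast
  {
    assume "normal_extension K L"
    then have "normal_core = L" using normal_imp_subset_normal_core[OF sub] le by blast
    then show "(dim over K) normal_core = (dim over K) L" by simp
  }
  assume "(dim over K) normal_core = (dim over K) L"
  then have "normal_core = L"
    using intermediate_eqI[OF subfield_normal_core K_subset_normal_core le L _ le] by simp
  then show "normal_extension K L" using normal_extension_normal_core(2) by simp
qed

end

theorem proposition2p12:
  fixes R :: "('a, 'b) ring_scheme" (structure) and K L :: "'a set"
  assumes "algebraic_closure R K"
    and "subfield L R" and "K \<subseteq> L" and "ring.finite_dimension R K L"
  shows
    "(ring.maximal_normal R K L =
        ring.compositum R (ring.maximal_galois R K L) (ring.maximal_purely_inseparable R K L)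
      \<and> ring.ascending_normal_index R K L =
        ring.ascending_index R K L * ring.inseparable_index R K L)
     \<and> ring.ascending_normal_index R K L * ring.separable_coindex R K L =
        (ring.dim R over K)
          (ring.compositum R (ring.maximal_separable R K L) (ring.maximal_purely_inseparable R K L))
     \<and> (ring.normal_extension R K L \<longleftrightarrow>
        ring.ascending_normal_index R K L = (ring.dim R over K) L)"
proof -
  interpret algebraic_closure R K by fact
  interpret finite_subextension R K L
    using assms subfield_axioms algebraically_closed_axioms
    by (intro finite_subextension.intro alg_closed_field.intro finite_subextension_axioms.intro)
  \<comment> \<open>Part (2) is arithmetic: a u = t i u = (t u) i = [L_S : K] [L_I : K], the degree
    of the compositum.\<close>
  show ?thesis
    unfolding ascending_normal_index_def ascending_index_def inseparable_index_def separable_coindex_def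
      maximal_normal_eq maximal_galois_eq maximal_separable_eq maximal_purely_inseparable_eq
    using normal_core_eq_compositum dim_normal_core dim_separable_compositum dim_separables
      normal_extension_iff_dim by simp
qed

end
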